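(* Let $r\ge1$, let $n=2r$ or $n=2r+1$, let $e\in\{1,-1\}$ and $N=[\frac{n+1}{2}]$. Regard $\mathbb P=\mathbb Q(q)[X_1,\dots,X_{r+1}]$ as a module over the $\imath$quantum group ${}^{\imath}\mathbf U$ via $u f=\varphi(u)f$, where $\varphi:{}^\imath\mathbf U\to\mathbf A_q$ is the homomorphism to the modified $q$-Weyl algebra and $\mathbf A_q$ acts on $\mathbb P$. Let $(\tau_i,\mathcal T_i)$ be either $(\tau'_{i,e},\mathcal T'_{i,e})$ or $(\tau''_{i,-e},\mathcal T''_{i,-e})$, $1\le i\le N$. Then for any $u\in{}^\imath\mathbf U$ and $f\in\mathbb P$, $$\mathcal T_i(uf)=\tau_i(u)\,\mathcal T_i(f).$$
   Context: Setup. Fix $r\ge1$, $n=2r$ or $n=2r+1$, $I=\{1,\dots,n\}$, $\rho_n(i)=n+1-i$, $N=[\frac{n+1}{2}]$ (so $N=r$ if $n=2r$, $N=r+1$ if $n=2r+1$). For $i,j\in I$: $i\cdot i=2$, $i\cdot j=-1$ if $|i-j|=1$, $i\cdot j=0$ otherwise. $e\in\{1,-1\}$ and $[x,y]_{\pm e}=xy-q^{\pm e}yx$. The $\imath$quantum group ${}^{\imath}\mathbf U$ (denoted $\mathbf U^{\jmath}$ if $n=2r$, $\mathbf U^{\imath}$ if $n=2r+1$) is the $\mathbb Q(q)$-algebra generated by $B_i$ ($i\in I$) and $K_i$ ($i\in I$, $\rho_n(i)\neq i$) with relations $K_iK_{\rho_n(i)}=1$; $K_iB_j=q^{j\cdot\rho_n(i)-j\cdot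 i}B_jK_i$; (it is understood that the $K_i$ commute with each other); $B_jB_i-B_iB_j=\delta_{\rho_n(i),j}\frac{K_i-K_{\rho_n(i)}}{q-q^{-1}}$ if $i\cdot j=0$; $B_i^2B_j-(q+q^{-1})B_iB_jB_i+B_jB_i^2=\delta_{i,\rho_n(i)}B_j-\delta_{j,\rho_n(i)}(q+q^{-1})B_i(q^{-1}\varsigma_iK_i+q^2\varsigma_{\rho_n(i)}K_{\rho_n(i)})$ if $i\cdot j=-1$, where $\varsigma_i=\delta_{i,r}+q^{-1}\delta_{i,r+1}$. The automorphisms $\tau'_{i,e},\tau''_{i,-e}$ of ${}^\imath\mathbf U$ ($1\le i\le N$) are the following (known, mutually inverse) $\mathbb Q(q)$-algebra automorphisms; generators $B_j$ not listed are fixed, and values on $K_j$ are given for $1\le j\le r$, the rest being determined by $K_{\rho_n(j)}=K_j^{-1}$. On $K_j$: for $i\le N-1$, $\tau'_{i,e}$ and $\tau''_{i,-e}$ send $K_i\mapsto K_{\rho_n(i)}$, $K_j\mapsto K_iK_j$ if $|i-j|=1$, and $K_j\mapsto K_j$ otherwise; for $i=N$ all $K_j$ are fixed. On $B_j$ for $i\le N-1$ (if $n=2r+1$ and $i=r$, the case $j=r+1$ is excluded here and treated below): $\tau'_{i,e}(B_i)=-B_{\rho_n(i)}K_{\rho_n(i)}^e$; $\tau'_{i,e}(B_{\rho_n(i)})=-K_i^eB_i$; $\tau'_{i,e}(B_j)=[B_i,B_j]_{-e}$ if $i\cdot j=-1$; $\tau'_{i,e}(B_j)=[B_j,B_{\rho_n(i)}]_e$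 if $\rho_n(i)\cdot j=-1$; $\tau''_{i,-e}(B_i)=-K_i^eB_{\rho_n(i)}$; $\tau''_{i,-e}(B_{\rho_n(i)})=-B_iK_{\rho_n(i)}^e$; $\tau''_{i,-e}(B_j)=[B_j,B_i]_{-e}$ if $i\cdot j=-1$; $\tau''_{i,-e}(B_j)=[B_{\rho_n(i)},B_j]_e$ if $\rho_n(i)\cdot j=-1$. For $n=2r+1$, $i=r$, $j=r+1$: $\tau'_{r,e}(B_{r+1})=[B_r,[B_{r+1},B_{r+2}]_e]_{-e}+B_{r+1}K_{\rho_n(r)}^e$, $\tau''_{r,-e}(B_{r+1})=[[B_r,B_{r+1}]_e,B_{r+2}]_{-e}+B_{r+1}K_{\rho_n(r)}^e$. For $n=2r$, $i=r$ (terms with indices outside $I$ omitted): $\tau'_{r,e}(B_{r-1})=q^{-e}[[B_{r-1},B_r]_e,B_{r+1}]_e-K_r^eB_{r-1}$, $\tau'_{r,e}(B_r)=K_r^eB_r$, $\tau'_{r,e}(B_{r+1})=B_{r+1}K_{\rho_n(r)}^e$, $\tau'_{r,e}(B_{r+2})=q^{-e}[[B_{r+2},B_{r+1}]_e,B_r]_e-B_{r+2}K_{\rho_n(r)}^e$; $\tau''_{r,-e}(B_{r-1})=q^{-e}[B_{r+1},[B_r,B_{r-1}]_e]_e-K_{\rho_n(r)}^eB_{r-1}$, $\tau''_{r,-e}(B_r)=K_{\rho_n(r)}^eB_r$, $\tau''_{r,-e}(B_{r+1})=B_{r+1}K_r^e$, $\tau''_{r,-e}(B_{r+2})=q^{-e}[B_r,[B_{r+1},B_{r+2}]_e]_e-B_{r+2}K_r^e$.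 For $n=2r+1$, $i=r+1$: $\tau'_{r+1,e}(B_r)=[B_{r+1},B_r]_{-e}$, $\tau'_{r+1,e}(B_{r+2})=[B_{r+2},B_{r+1}]_e$; $\tau''_{r+1,-e}(B_r)=[B_{r+1},B_r]_e$, $\tau''_{r+1,-e}(B_{r+2})=[B_{r+2},B_{r+1}]_{-e}$. The modified $q$-Weyl algebra $\mathbf A_q$ ($\mathbf A_q^\jmath$ if $n=2r$, $\mathbf A_q^\imath$ if $n=2r+1$): put $c_i=1$ for $i\le r$, $c_{r+1}=2$ if $n=2r$, $c_{r+1}=1$ if $n=2r+1$. It is the $\mathbb Q(q)$-algebra generated by $\mathfrak d_i,\mathfrak x_i,\mathfrak m_i^{\pm1}$ ($1\le i\le r+1$) with relations: $\mathfrak m_i\mathfrak m_i^{-1}=\mathfrak m_i^{-1}\mathfrak m_i=1$; all $\mathfrak m$'s commute, all $\mathfrak d$'s commute, all $\mathfrak x$'s commute; for $i\ne j$, $\mathfrak d_i\mathfrak m_j=\mathfrak m_j\mathfrak d_i$, $\mathfrak x_i\mathfrak m_j=\mathfrak m_j\mathfrak x_i$, $\mathfrak d_i\mathfrak x_j=\mathfrak x_j\mathfrak d_i$; $\mathfrak d_i\mathfrak m_i=q^{c_i}\mathfrak m_i\mathfrak d_i$, $\mathfrak x_i\mathfrak m_i=q^{-c_i}\mathfrak m_i\mathfrak x_i$; $\mathfrak d_i\mathfrak x_i=\frac{q^{c_i}\mathfrak m_i-q^{-c_i}\mathfrak m_i^{-1}}{q-q^{-1}}$, $\mathfrak x_i\mathfrak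 d_i=\frac{\mathfrak m_i-\mathfrak m_i^{-1}}{q-q^{-1}}$. The $\mathbb Q(q)$-algebra homomorphism $\varphi:{}^\imath\mathbf U\to\mathbf A_q$ (known to exist): $\varphi(B_i)=\mathfrak x_{i+1}\mathfrak d_i$ and $\varphi(B_{\rho_n(i)})=\mathfrak x_i\mathfrak d_{i+1}$ for $1\le i\le r$; $\varphi(B_{r+1})=\mathfrak x_{r+1}\mathfrak d_{r+1}$ if $n=2r+1$; if $n=2r$, $\varphi(K_i)=q^{-\delta_{i,r}}\mathfrak m_i\mathfrak m_{i+1}^{-1}$ for $1\le i\le r$; if $n=2r+1$, $\varphi(K_i)=\mathfrak m_i\mathfrak m_{i+1}^{-1}$ for $1\le i\le r$; and $\varphi(K_{\rho_n(i)})=\varphi(K_i)^{-1}$. Action of $\mathbf A_q$ on $\mathbb P=\mathbb Q(q)[X_1,\dots,X_{r+1}]$: for $\mathbf a=(a_1,\dots,a_{r+1})\in\mathbb Z_{\ge0}^{r+1}$ and $\mathbf X^{\mathbf a}=X_1^{a_1}\cdots X_{r+1}^{a_{r+1}}$, with $[k]=\frac{q^k-q^{-k}}{q-q^{-1}}$ and $\mathbf e_i$ the $i$-th standard unit tuple, $\mathfrak d_i\mathbf X^{\mathbf a}=[c_ia_i]\mathbf X^{\mathbf a-\mathbf e_i}$ (zero if $a_i=0$), $\mathfrak x_i\mathbf X^{\mathbf a}=\mathbf X^{\mathbf a+\mathbf e_i}$, $\mathfrak m_i\mathbf X^{\mathbf a}=q^{c_ia_i}\mathbf X^{\mathbf a}$.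 The $\mathbb Q(q)$-linear operators $\mathcal T'_{i,e},\mathcal T''_{i,-e}$ on $\mathbb P$ ($1\le i\le N$), where $s_i$ switches $X_i$ and $X_{i+1}$ in $\mathbf X^{\mathbf a}$: for $i\le N-1$, $\mathcal T'_{i,e}(\mathbf X^{\mathbf a})=(-q^{-e})^{-a_{i+1}}q^{ea_ia_{i+1}}(s_i\mathbf X^{\mathbf a})$ and $\mathcal T''_{i,-e}(\mathbf X^{\mathbf a})=(-q^{-e})^{a_i}q^{-ea_ia_{i+1}}(s_i\mathbf X^{\mathbf a})$; for $n=2r$, $i=r$, $\mathcal T'_{r,e}(\mathbf X^{\mathbf a})=q^{\frac12ea_r^2+\frac32ea_r-ea_{r+1}+2ea_ra_{r+1}}\mathbf X^{\mathbf a}$ and $\mathcal T''_{r,-e}(\mathbf X^{\mathbf a})=q^{-\frac12ea_r^2-\frac32ea_r+ea_{r+1}-2ea_ra_{r+1}}\mathbf X^{\mathbf a}$; for $n=2r+1$, $i=r+1$, $\mathcal T'_{r+1,e}(\mathbf X^{\mathbf a})=q^{\frac12ea_{r+1}^2-\frac12ea_{r+1}}\mathbf X^{\mathbf a}$ and $\mathcal T''_{r+1,-e}(\mathbf X^{\mathbf a})=q^{-\frac12ea_{r+1}^2+\frac12ea_{r+1}}\mathbf X^{\mathbf a}$. *)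

theory Defs
  imports
    "HOL-Library.Poly_Mapping"
    "HOL-Combinatorics.Transposition"
    "HOL-Computational_Algebra.Fraction_Field"
    "HOL-Computational_Algebra.Polynomial"
    "HOL-Algebra.QuotRing"
begin

section \<open>The ground field \<open>\<rat>(q)\<close>\<close>

type_synonym qfield = "rat poly fract"

definition q :: qfield where
  "q = Fraction_Field.Fract [:0, 1:] 1"

definition qint :: "int \<Rightarrow> qfield" where
  "qint k = (q powi k - q powi (- k)) / (q - inverse q)"


section \<open>Algebras over \<open>\<rat>(q)\<close> given by generators and relations\<close>

text \<open>Words under concatenation. The monoid is written additively, because the product of
  \<^type>\<open>poly_mapping\<close> is convolution over an additive monoid; with keys in
  \<open>'g fword\<close> it is the product of the free associative algebra on \<open>'g\<close>.\<close>

datatype 'g fword = FWord (letters: "'g list")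

instantiation fword :: (type) monoid_add
begin

definition zero_fword :: "'a fword" where
  "0 = FWord []"

definition plus_fword :: "'a fword \<Rightarrow> 'a fword \<Rightarrow> 'a fword" where
  "u + v = FWord (letters u @ letters v)"

instance
  by standard (auto simp: zero_fword_def plus_fword_def)

end

type_synonym 'g falg = "'g fword \<Rightarrow>\<^sub>0 qfield"

definition gen :: "'g \<Rightarrow> 'g falg" where
  "gen g = Poly_Mapping.single (FWord [g]) 1"

definition scal :: "qfield \<Rightarrow> ('a::monoid_add \<Rightarrow>\<^sub>0 qfield)" where
  "scal c = Poly_Mapping.single 0 c"

definition free_alg :: "'g set \<Rightarrow> 'g falg ring" where
  "free_alg G = \<lparr>carrier = {x. \<forall>w \<in> Poly_Mapping.keys x. set (letters w) \<subseteq> G},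
     mult = (*), one = 1, zero = 0, add = (+)\<rparr>"

text \<open>A presentation is a pair of a set of generators and a set of relators (elements of the free
  algebra that are set to zero). \<^const>\<open>genideal\<close> is the two-sided ideal
  generated by the relators, and an element of the presented algebra is a coset.\<close>

type_synonym 'g presentation = "'g set \<times> 'g falg set"

definition rel_ideal :: "'g presentation \<Rightarrow> 'g falg set" where
  "rel_ideal P = genideal (free_alg (fst P)) (snd P)"

definition presented :: "'g presentation \<Rightarrow> 'g falg set ring" where
  "presented P = free_alg (fst P) Quot rel_ideal P"

definition cls :: "'g presentation \<Rightarrow> 'g falg \<Rightarrow> 'g falg set" where
  "cls P x = rel_ideal P +>\<^bsub>free_alg (fst P)\<^esub> x"

definition alg_hom ::
    "'g presentation \<Rightarrow> 'h presentation \<Rightarrow> ('g falg set \<Rightarrow> 'h falg set) set" where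
  "alg_hom P Q = {h \<in> ring_hom (presented P) (presented Q).
     \<forall>c. h (cls P (scal c)) = cls Q (scal c)}"

definition alg_aut :: "'g presentation \<Rightarrow> ('g falg set \<Rightarrow> 'g falg set) set" where
  "alg_aut P = {h \<in> alg_hom P P. bij_betw h (carrier (presented P)) (carrier (presented P))}"

lemma free_alg_simps [simp]:
  "x \<in> carrier (free_alg G) \<longleftrightarrow> (\<forall>w \<in> Poly_Mapping.keys x. set (letters w) \<subseteq> G)"
  "mult (free_alg G) = (*)" "one (free_alg G) = 1"
  "zero (free_alg G) = 0" "add (free_alg G) = (+)"
  by (auto simp: free_alg_def)

lemma free_alg_mult_closed:
  assumes "x \<in> carrier (free_alg G)" "y \<in> carrier (free_alg G)"
  shows "x * y \<in> carrier (free_alg G)"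
  using assms keys_mult[of x y] by (fastforce simp: plus_fword_def)

lemma free_alg_add_closed:
  assumes "x \<in> carrier (free_alg G)" "y \<in> carrier (free_alg G)"
  shows "x + y \<in> carrier (free_alg G)"
  using assms Poly_Mapping.keys_add[of x y] by auto

lemma free_alg_uminus_closed:
  "x \<in> carrier (free_alg G) \<Longrightarrow> - x \<in> carrier (free_alg G)"
  by simp

lemma free_alg_diff_closed:
  assumes "x \<in> carrier (free_alg G)" "y \<in> carrier (free_alg G)"
  shows "x - y \<in> carrier (free_alg G)"
  using free_alg_add_closed[OF assms(1) free_alg_uminus_closed[OF assms(2)]] by simp

lemma free_alg_scal_closed: "scal c \<in> carrier (free_alg G)"
  by (simp add: scal_def zero_fword_def)

lemma free_alg_one_closed: "1 \<in> carrier (free_alg G)"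
  by (simp add: zero_fword_def)

lemma free_alg_zero_closed: "0 \<in> carrier (free_alg G)"
  by simp

lemma free_alg_gen_closed: "gen g \<in> carrier (free_alg G) \<longleftrightarrow> g \<in> G"
  by (simp add: gen_def)

lemma free_alg_if_closed:
  assumes "b \<Longrightarrow> x \<in> carrier (free_alg G)" "\<not> b \<Longrightarrow> y \<in> carrier (free_alg G)"
  shows "(if b then x else y) \<in> carrier (free_alg G)"
  using assms by simp

lemmas free_alg_closed = free_alg_if_closed
  free_alg_mult_closed free_alg_add_closed free_alg_diff_closed
  free_alg_scal_closed free_alg_one_closed free_alg_zero_closed

lemma ring_free_alg: "ring (free_alg G)"
proof (rule ringI)
  show "abelian_group (free_alg G)"
  proof (rule abelian_groupI)
    fix x assume "x \<in> carrier (free_alg G)"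
    then show "\<exists>y\<in>carrier (free_alg G). y \<oplus>\<^bsub>free_alg G\<^esub> x = \<zero>\<^bsub>free_alg G\<^esub>"
      by (intro bexI[of _ "- x"]) auto
  qed (simp_all del: free_alg_simps(1) add: free_alg_add_closed free_alg_zero_closed
      add.assoc add.commute)
  show "Group.monoid (free_alg G)"
    by (rule monoidI) (simp_all del: free_alg_simps(1)
        add: free_alg_mult_closed free_alg_one_closed mult.assoc)
qed (auto simp: algebra_simps)

section \<open>The \<open>\<imath>\<close>quantum group\<close>

text \<open>Both parities of \<open>n\<close> are treated together; \<open>r\<close> and \<open>n\<close> are separate parameters,
  used only with \<open>n = 2 * r\<close> or \<open>n = 2 * r + 1\<close>.\<close>

datatype igen = GB nat | GK nat

abbreviation B :: "nat \<Rightarrow> igen falg" where "B i \<equiv> gen (GB i)"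
abbreviation K :: "nat \<Rightarrow> igen falg" where "K i \<equiv> gen (GK i)"

definition rho :: "nat \<Rightarrow> nat \<Rightarrow> nat" where
  "rho n i = n + 1 - i"

definition cdot :: "nat \<Rightarrow> nat \<Rightarrow> int" where
  "cdot i j = (if i = j then 2 else if i = j + 1 \<or> j = i + 1 then - 1 else 0)"

definition varsig :: "nat \<Rightarrow> nat \<Rightarrow> qfield" where
  "varsig r i = of_bool (i = r) + inverse q * of_bool (i = r + 1)"

definition iU_gens :: "nat \<Rightarrow> igen set" where
  "iU_gens n = GB ` {1..n} \<union> GK ` {i \<in> {1..n}. rho n i \<noteq> i}"

definition iU_rels :: "nat \<Rightarrow> nat \<Rightarrow> igen falg set" where
  "iU_rels r n =
     {K i * K (rho n i) - 1 | i. i \<in> {1..n} \<and> rho n i \<noteq> i}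
   \<union> {K i * K j - K j * K i | i j.
        i \<in> {1..n} \<and> rho n i \<noteq> i \<and> j \<in> {1..n} \<and> rho n j \<noteq> j}
   \<union> {K i * B j - scal (q powi (cdot j (rho n i) - cdot j i)) * B j * K i | i j.
        i \<in> {1..n} \<and> rho n i \<noteq> i \<and> j \<in> {1..n}}
   \<union> {B j * B i - B i * B j
        - (if rho n i = j then scal (inverse (q - inverse q)) * (K i - K (rho n i)) else 0) | i j.
        i \<in> {1..n} \<and> j \<in> {1..n} \<and> cdot i j = 0}
   \<union> {B i * B i * B j - scal (q + inverse q) * B i * B j * B i + B j * B i * B i
        - ((if i = rho n i then B j else 0)
           - (if j = rho n i
              then scal (q + inverse q) * B i *
                (scal (inverse q * varsig r i) * K i
                 + scal (q\<^sup>2 * varsig r (rho n i)) * K (rho n i))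
              else 0)) | i j.
        i \<in> {1..n} \<and> j \<in> {1..n} \<and> cdot i j = - 1}"

definition iU :: "nat \<Rightarrow> nat \<Rightarrow> igen presentation" where
  "iU r n = (iU_gens n, iU_rels r n)"

lemma iU_rels_closed: "iU_rels r n \<subseteq> carrier (free_alg (iU_gens n))"
proof -
  have K: "K i \<in> carrier (free_alg (iU_gens n))" if "i \<in> {1..n}" "rho n i \<noteq> i" for i
    using that by (simp only: free_alg_gen_closed) (auto simp: iU_gens_def)
  have B: "B i \<in> carrier (free_alg (iU_gens n))" if "i \<in> {1..n}" for i
    using that by (simp only: free_alg_gen_closed) (auto simp: iU_gens_def)
  show ?thesis
    unfolding iU_rels_def
    apply (intro subsetI)
    apply (elim UnE CollectE exE conjE)
        apply (hypsubst, intro free_alg_closed B K; auto simp: cdot_def rho_def split: if_splits)+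
    done
qed


section \<open>The operators \<open>\<tau>'\<close> and \<open>\<tau>''\<close>\<close>

text \<open>\<open>[x, y]\<close> with subscript \<open>k\<close> is \<open>x y - q\<^sup>k y x\<close>.\<close>

definition qbr :: "int \<Rightarrow> 'g falg \<Rightarrow> 'g falg \<Rightarrow> 'g falg" where
  "qbr k x y = x * y - scal (q powi k) * y * x"

text \<open>\<open>K i\<close> to the power \<open>e\<close>, for \<open>e = 1\<close> or \<open>e = -1\<close>.\<close>

definition Kpow :: "nat \<Rightarrow> int \<Rightarrow> nat \<Rightarrow> igen falg" where
  "Kpow n e i = (if e = 1 then K i else K (rho n i))"

definition Nr :: "nat \<Rightarrow> nat" where
  "Nr n = (n + 1) div 2"

text \<open>Common values of both families on \<open>K j\<close>, \<open>1 \<le> j \<le> r\<close>.\<close>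

definition tau_K :: "nat \<Rightarrow> nat \<Rightarrow> nat \<Rightarrow> igen falg" where
  "tau_K n i j =
     (if i = Nr n then K j
      else if j = i then K (rho n i)
      else if i = j + 1 \<or> j = i + 1 then K i * K j
      else K j)"

text \<open>Values on \<open>B j\<close>, \<open>1 \<le> j \<le> n\<close>.\<close>

definition tau1_B :: "nat \<Rightarrow> nat \<Rightarrow> int \<Rightarrow> nat \<Rightarrow> nat \<Rightarrow> igen falg" where
  "tau1_B r n e i j =
     (if n = 2 * r \<and> i = r then
        (if j + 1 = r then
           scal (q powi (- e)) * qbr e (qbr e (B (r - 1)) (B r)) (B (r + 1))
             - Kpow n e r * B (r - 1)
         else if j = r then Kpow n e r * B r
         else if j = r + 1 then B (r + 1) * Kpow n e (rho n r)
         else if j = r + 2 then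
           scal (q powi (- e)) * qbr e (qbr e (B (r + 2)) (B (r + 1))) (B r)
             - B (r + 2) * Kpow n e (rho n r)
         else B j)
      else if n = 2 * r + 1 \<and> i = r + 1 then
        (if j = r then qbr (- e) (B (r + 1)) (B r)
         else if j = r + 2 then qbr e (B (r + 2)) (B (r + 1))
         else B j)
      else if n = 2 * r + 1 \<and> i = r \<and> j = r + 1 then
        qbr (- e) (B r) (qbr e (B (r + 1)) (B (r + 2))) + B (r + 1) * Kpow n e (rho n r)
      else if j = i then - (B (rho n i) * Kpow n e (rho n i))
      else if j = rho n i then - (Kpow n e i * B i)
      else if cdot i j = - 1 then qbr (- e) (B i) (B j)
      else if cdot (rho n i) j = - 1 then qbr e (B j) (B (rho n i))
      else B j)"

text \<open>\<open>tau2_B r n e i\<close> describes \<open>\<tau>''\<close> with subscripts \<open>i, -e\<close>.\<close>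

definition tau2_B :: "nat \<Rightarrow> nat \<Rightarrow> int \<Rightarrow> nat \<Rightarrow> nat \<Rightarrow> igen falg" where
  "tau2_B r n e i j =
     (if n = 2 * r \<and> i = r then
        (if j + 1 = r then
           scal (q powi (- e)) * qbr e (B (r + 1)) (qbr e (B r) (B (r - 1)))
             - Kpow n e (rho n r) * B (r - 1)
         else if j = r then Kpow n e (rho n r) * B r
         else if j = r + 1 then B (r + 1) * Kpow n e r
         else if j = r + 2 then
           scal (q powi (- e)) * qbr e (B r) (qbr e (B (r + 1)) (B (r + 2)))
             - B (r + 2) * Kpow n e r
         else B j)
      else if n = 2 * r + 1 \<and> i = r + 1 then
        (if j = r then qbr e (B (r + 1)) (B r)
         else if j = r + 2 then qbr (- e) (B (r + 2)) (B (r + 1))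
         else B j)
      else if n = 2 * r + 1 \<and> i = r \<and> j = r + 1 then
        qbr (- e) (qbr e (B r) (B (r + 1))) (B (r + 2)) + B (r + 1) * Kpow n e (rho n r)
      else if j = i then - (Kpow n e i * B (rho n i))
      else if j = rho n i then - (B i * Kpow n e (rho n i))
      else if cdot i j = - 1 then qbr (- e) (B j) (B i)
      else if cdot (rho n i) j = - 1 then qbr e (B (rho n i)) (B j)
      else B j)"

text \<open>An algebra automorphism is determined by these values: \<open>K (rho n j)\<close> is inverse
  to \<open>K j\<close> in the presented algebra. That automorphisms with these values exist is
  known and is not established here.\<close>

definition is_tau1 ::
    "nat \<Rightarrow> nat \<Rightarrow> int \<Rightarrow> nat \<Rightarrow> (igen falg set \<Rightarrow> igen falg set) \<Rightarrow> bool" where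
  "is_tau1 r n e i \<tau> \<longleftrightarrow> \<tau> \<in> alg_aut (iU r n) \<and>
     (\<forall>j \<in> {1..n}. \<tau> (cls (iU r n) (B j)) = cls (iU r n) (tau1_B r n e i j)) \<and>
     (\<forall>j \<in> {1..r}. \<tau> (cls (iU r n) (K j)) = cls (iU r n) (tau_K n i j))"

definition is_tau2 ::
    "nat \<Rightarrow> nat \<Rightarrow> int \<Rightarrow> nat \<Rightarrow> (igen falg set \<Rightarrow> igen falg set) \<Rightarrow> bool" where
  "is_tau2 r n e i \<tau> \<longleftrightarrow> \<tau> \<in> alg_aut (iU r n) \<and>
     (\<forall>j \<in> {1..n}. \<tau> (cls (iU r n) (B j)) = cls (iU r n) (tau2_B r n e i j)) \<and>
     (\<forall>j \<in> {1..r}. \<tau> (cls (iU r n) (K j)) = cls (iU r n) (tau_K n i j))"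


section \<open>The modified \<open>q\<close>-Weyl algebra\<close>

datatype wgen = GD nat | GX nat | GM nat | GMinv nat

abbreviation Dw :: "nat \<Rightarrow> wgen falg" where "Dw i \<equiv> gen (GD i)"
abbreviation Xw :: "nat \<Rightarrow> wgen falg" where "Xw i \<equiv> gen (GX i)"
abbreviation Mw :: "nat \<Rightarrow> wgen falg" where "Mw i \<equiv> gen (GM i)"
abbreviation Minvw :: "nat \<Rightarrow> wgen falg" where "Minvw i \<equiv> gen (GMinv i)"

definition cc :: "nat \<Rightarrow> nat \<Rightarrow> nat \<Rightarrow> nat" where
  "cc r n i = (if n = 2 * r \<and> i = r + 1 then 2 else 1)"

definition Aq_gens :: "nat \<Rightarrow> wgen set" where
  "Aq_gens r = GD ` {1..r+1} \<union> GX ` {1..r+1} \<union> GM ` {1..r+1} \<union> GMinv ` {1..r+1}"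

definition Aq_rels :: "nat \<Rightarrow> nat \<Rightarrow> wgen falg set" where
  "Aq_rels r n =
     (\<Union>i \<in> {1..r+1}.
       {Mw i * Minvw i - 1,
        Minvw i * Mw i - 1,
        Dw i * Mw i - scal (q powi int (cc r n i)) * Mw i * Dw i,
        Xw i * Mw i - scal (q powi (- int (cc r n i))) * Mw i * Xw i,
        Dw i * Xw i - scal (inverse (q - inverse q)) *
          (scal (q powi int (cc r n i)) * Mw i - scal (q powi (- int (cc r n i))) * Minvw i),
        Xw i * Dw i - scal (inverse (q - inverse q)) * (Mw i - Minvw i)})
   \<union> (\<Union>i \<in> {1..r+1}. \<Union>j \<in> {1..r+1}.
       {Mw i * Mw j - Mw j * Mw i,
        Dw i * Dw j - Dw j * Dw i,
        Xw i * Xw j - Xw j * Xw i})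
   \<union> (\<Union>i \<in> {1..r+1}. \<Union>j \<in> {1..r+1} - {i}.
       {Dw i * Mw j - Mw j * Dw i,
        Xw i * Mw j - Mw j * Xw i,
        Dw i * Xw j - Xw j * Dw i})"

definition Aq :: "nat \<Rightarrow> nat \<Rightarrow> wgen presentation" where
  "Aq r n = (Aq_gens r, Aq_rels r n)"

lemma Aq_rels_closed: "Aq_rels r n \<subseteq> carrier (free_alg (Aq_gens r))"
proof -
  have D: "Dw i \<in> carrier (free_alg (Aq_gens r))" if "i \<in> {1..r+1}" for i
    using that by (simp only: free_alg_gen_closed) (auto simp: Aq_gens_def)
  have X: "Xw i \<in> carrier (free_alg (Aq_gens r))" if "i \<in> {1..r+1}" for i
    using that by (simp only: free_alg_gen_closed) (auto simp: Aq_gens_def)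
  have M: "Mw i \<in> carrier (free_alg (Aq_gens r))" if "i \<in> {1..r+1}" for i
    using that by (simp only: free_alg_gen_closed) (auto simp: Aq_gens_def)
  have M': "Minvw i \<in> carrier (free_alg (Aq_gens r))" if "i \<in> {1..r+1}" for i
    using that by (simp only: free_alg_gen_closed) (auto simp: Aq_gens_def)
  show ?thesis
    unfolding Aq_rels_def
    by (intro subsetI, elim UnE UN_E insertE emptyE)
      (hypsubst, intro free_alg_closed D X M M'; simp)+
qed

text \<open>The homomorphism \<open>\<phi>\<close> from the \<open>\<imath>\<close>quantum group to the \<open>q\<close>-Weyl algebra,
  characterised by its values on generators.\<close>

definition phi_K :: "nat \<Rightarrow> nat \<Rightarrow> nat \<Rightarrow> wgen falg" where
  "phi_K r n i =
     (if n = 2 * r then scal (q powi (- of_bool (i = r))) * Mw i * Minvw (i + 1)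
      else Mw i * Minvw (i + 1))"

definition is_phi :: "nat \<Rightarrow> nat \<Rightarrow> (igen falg set \<Rightarrow> wgen falg set) \<Rightarrow> bool" where
  "is_phi r n \<phi> \<longleftrightarrow> \<phi> \<in> alg_hom (iU r n) (Aq r n) \<and>
     (\<forall>i \<in> {1..r}.
        \<phi> (cls (iU r n) (B i)) = cls (Aq r n) (Xw (i + 1) * Dw i) \<and>
        \<phi> (cls (iU r n) (B (rho n i))) = cls (Aq r n) (Xw i * Dw (i + 1)) \<and>
        \<phi> (cls (iU r n) (K i)) = cls (Aq r n) (phi_K r n i) \<and>
        \<phi> (cls (iU r n) (K (rho n i))) =
          inv\<^bsub>presented (Aq r n)\<^esub> (\<phi> (cls (iU r n) (K i)))) \<and>
     (n = 2 * r + 1 \<longrightarrow>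
        \<phi> (cls (iU r n) (B (r + 1))) = cls (Aq r n) (Xw (r + 1) * Dw (r + 1)))"


section \<open>The polynomial module\<close>

text \<open>Polynomials are finitely supported maps from exponent vectors to coefficients; exponent
  vectors are finitely supported maps on variable indices, and \<open>polys r\<close> restricts the
  indices to \<open>1, \<dots>, r + 1\<close>.\<close>

type_synonym expo = "nat \<Rightarrow>\<^sub>0 nat"
type_synonym qpoly = "expo \<Rightarrow>\<^sub>0 qfield"

definition polys :: "nat \<Rightarrow> qpoly set" where
  "polys r = {f. \<forall>a \<in> Poly_Mapping.keys f. Poly_Mapping.keys a \<subseteq> {1..r+1}}"

abbreviation Xmon :: "expo \<Rightarrow> qpoly" where
  "Xmon a \<equiv> Poly_Mapping.single a 1"

abbreviation ex :: "expo \<Rightarrow> nat \<Rightarrow> int" where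
  "ex a i \<equiv> int (Poly_Mapping.lookup a i)"

abbreviation unit_expo :: "nat \<Rightarrow> expo" where
  "unit_expo i \<equiv> Poly_Mapping.single i 1"

definition lin_ext :: "(expo \<Rightarrow> qpoly) \<Rightarrow> qpoly \<Rightarrow> qpoly" where
  "lin_ext g f = (\<Sum>a \<in> Poly_Mapping.keys f. scal (Poly_Mapping.lookup f a) * g a)"

primrec gen_op :: "nat \<Rightarrow> nat \<Rightarrow> wgen \<Rightarrow> qpoly \<Rightarrow> qpoly" where
  "gen_op r n (GD i) = lin_ext (\<lambda>a. if ex a i = 0 then 0
     else scal (qint (int (cc r n i) * ex a i)) * Xmon (a - unit_expo i))"
| "gen_op r n (GX i) = lin_ext (\<lambda>a. Xmon (a + unit_expo i))"
| "gen_op r n (GM i) = lin_ext (\<lambda>a. scal (q powi (int (cc r n i) * ex a i)) * Xmon a)"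
| "gen_op r n (GMinv i) = lin_ext (\<lambda>a. scal (q powi (- (int (cc r n i) * ex a i))) * Xmon a)"

text \<open>A word acts by the composition of its letters, the last letter first.\<close>

definition free_act :: "nat \<Rightarrow> nat \<Rightarrow> wgen falg \<Rightarrow> qpoly \<Rightarrow> qpoly" where
  "free_act r n x f =
     (\<Sum>w \<in> Poly_Mapping.keys x. scal (Poly_Mapping.lookup x w) * foldr (gen_op r n) (letters w) f)"

text \<open>All representatives of an element of the \<open>q\<close>-Weyl algebra act in the same way;
  \<open>weyl_act\<close> is their common value.\<close>

definition weyl_act :: "nat \<Rightarrow> nat \<Rightarrow> wgen falg set \<Rightarrow> qpoly \<Rightarrow> qpoly" where
  "weyl_act r n U f = the_elem ((\<lambda>x. free_act r n x f) ` U)"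


section \<open>The operators \<open>\<T>'\<close> and \<open>\<T>''\<close> on polynomials\<close>

definition swap_expo :: "nat \<Rightarrow> expo \<Rightarrow> expo" where
  "swap_expo i a = Poly_Mapping.map_key (transpose i (i + 1)) a"

text \<open>The halved exponents are integers, so \<open>div 2\<close> is exact.\<close>

definition T1 :: "nat \<Rightarrow> nat \<Rightarrow> int \<Rightarrow> nat \<Rightarrow> qpoly \<Rightarrow> qpoly" where
  "T1 r n e i = lin_ext (\<lambda>a.
     if i < Nr n then
       scal ((- (q powi (- e))) powi (- ex a (i + 1)) * q powi (e * ex a i * ex a (i + 1)))
         * Xmon (swap_expo i a)
     else if n = 2 * r then
       scal (q powi ((e * (ex a r)\<^sup>2 + 3 * e * ex a r) div 2
                     - e * ex a (r + 1) + 2 * e * ex a r * ex a (r + 1))) * Xmon a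
     else
       scal (q powi ((e * (ex a (r + 1))\<^sup>2 - e * ex a (r + 1)) div 2)) * Xmon a)"

text \<open>\<open>T2 r n e i\<close> is \<open>\<T>''\<close> with subscripts \<open>i, -e\<close>.\<close>

definition T2 :: "nat \<Rightarrow> nat \<Rightarrow> int \<Rightarrow> nat \<Rightarrow> qpoly \<Rightarrow> qpoly" where
  "T2 r n e i = lin_ext (\<lambda>a.
     if i < Nr n then
       scal ((- (q powi (- e))) powi (ex a i) * q powi (- (e * ex a i * ex a (i + 1))))
         * Xmon (swap_expo i a)
     else if n = 2 * r then
       scal (q powi ((- (e * (ex a r)\<^sup>2) - 3 * e * ex a r) div 2
                     + e * ex a (r + 1) - 2 * e * ex a r * ex a (r + 1))) * Xmon a
     else
       scal (q powi ((- (e * (ex a (r + 1))\<^sup>2) + e * ex a (r + 1)) div 2)) * Xmon a)"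

end

theory Submission
  imports Defs
begin

text \<open>Both sides of the identity are multiplicative in \<open>u\<close>: if \<open>\<T> (u f) = \<tau> u (\<T> f)\<close> holds for all \<open>f\<close>
  and for two elements \<open>u\<close>, it holds for their sum and product, and it holds for scalars because
  \<open>\<T>\<close> is linear. Hence it suffices to treat the generators \<open>B\<^sub>j\<close> and \<open>K\<^sub>j\<close>, where the identity becomes
  a statement about explicit operators (\<open>intertwine_extend\<close>, \<open>intertwine_from_gens\<close>).

  Under \<open>\<phi>\<close> every generator acts by \<open>X\<^sup>a \<mapsto> c(a) X\<^sup>a\<^sup>'\<close> for a shift \<open>a'\<close> of \<open>a\<close>. So does \<open>\<T>\<close>, where
  \<open>a'\<close> is \<open>a\<close> itself or arises from \<open>a\<close> by an exchange of two entries. The only obstacle to a uniform calculation is the boundary \<open>a\<^sub>i = 0\<close>. It disappears when a polynomial is replaced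
  by its coefficient family, a function on all integral vectors that is zero on those that are not exponents
  of monomials. The same formulas define operators on arbitrary functions of integral vectors. These
  operators satisfy the relations of the \<open>q\<close>-Weyl algebra everywhere, and the embedding of polynomials
  commutes with them because the coefficient \<open>[0]\<close> of a derivative that would leave the polynomials vanishes
  (\<open>weyl_op_kills_Aq_rels\<close>, \<open>coeff_fun_weyl_act\<close>).

  On functions each generator identity says that finitely many monomial operators send a function to
  multiples of the same shifted function, so it is an equality of coefficients. With \<open>Q = q\<^sup>e\<close> the quantum
  integers are \<open>[k] = (Q\<^sup>k - Q\<^sup>-\<^sup>k) / (Q - Q\<^sup>-\<^sup>1)\<close> for both signs \<open>e\<close>, and a shift by one changes the coefficient
  of \<open>\<T>\<close> only by a sign and a monomial in \<open>Q\<close> and the \<open>Q\<close>-powers of the exponents. After cancelling the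
  coefficient of \<open>\<T>\<close> a polynomial identity in \<open>Q\<close>, a few such powers and their inverses
  remains, which Groebner bases decide. Three families of operators occur: the braidings
  that exchange two variables (\<open>i < N\<close>), and two diagonal operators for \<open>i = N\<close>, one for each parity of \<open>n\<close>.\<close>

section \<open>Representations of presented algebras\<close>

text \<open>Coefficient families indexed by integral exponent vectors, without a condition on the support.\<close>
type_synonym laurent = "(nat \<Rightarrow> int) \<Rightarrow> qfield"

definition linear_op :: "(laurent \<Rightarrow> laurent) \<Rightarrow> bool" where
  "linear_op T \<longleftrightarrow> (\<forall>F G. T (\<lambda>a. F a + G a) = (\<lambda>a. T F a + T G a)) \<and>
     (\<forall>c F. T (\<lambda>a. c * F a) = (\<lambda>a. c * T F a))"

lemma linear_op_add: "linear_op T \<Longrightarrow> T (\<lambda>a. F a + G a) = (\<lambda>a. T F a + T G a)"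
  by (simp add: linear_op_def)

lemma linear_op_scale: "linear_op T \<Longrightarrow> T (\<lambda>a. c * F a) = (\<lambda>a. c * T F a)"
  by (simp add: linear_op_def)

lemma linear_op_zero: "linear_op T \<Longrightarrow> T (\<lambda>a. 0) = (\<lambda>a. 0)"
  using linear_op_scale[of T 0 "\<lambda>a. 0"] by simp

lemma linear_op_sum:
  assumes "linear_op T"
  shows "T (\<lambda>a. \<Sum>i\<in>I. c i * F i a) = (\<lambda>a. \<Sum>i\<in>I. c i * T (F i) a)"
proof (induction I rule: infinite_finite_induct)
  case (insert i I)
  then show ?case
    using linear_op_add[OF assms, of "\<lambda>a. c i * F i a" "\<lambda>a. \<Sum>i\<in>I. c i * F i a"]
      linear_op_scale[OF assms, of "c i" "F i"] by simp
qed (simp_all add: linear_op_zero[OF assms])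

lemma linear_op_id: "linear_op (\<lambda>F. F)"
  by (simp add: linear_op_def)

text \<open>The operators \<open>op g\<close> make the free algebra on the letters \<open>g\<close> act on coefficient families.\<close>
definition word_act :: "('g \<Rightarrow> laurent \<Rightarrow> laurent) \<Rightarrow> 'g falg \<Rightarrow> laurent \<Rightarrow> laurent" where
  "word_act op x F a =
     (\<Sum>w\<in>Poly_Mapping.keys x. Poly_Mapping.lookup x w * foldr op (letters w) F a)"

lemma word_act_superset:
  assumes "finite S" "Poly_Mapping.keys x \<subseteq> S"
  shows "word_act op x F a = (\<Sum>w\<in>S. Poly_Mapping.lookup x w * foldr op (letters w) F a)"
  unfolding word_act_def using assms by (intro sum.mono_neutral_left) (auto simp: in_keys_iff)

lemma word_act_add: "word_act op (x + y) F = (\<lambda>a. word_act op x F a + word_act op y F a)"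
proof
  fix a
  let ?S = "Poly_Mapping.keys x \<union> Poly_Mapping.keys y"
  have "Poly_Mapping.keys (x + y) \<subseteq> ?S" by (rule Poly_Mapping.keys_add)
  then show "word_act op (x + y) F a = word_act op x F a + word_act op y F a"
    by (simp add: word_act_superset[of ?S] lookup_add sum.distrib distrib_right)
qed

lemma word_act_zero: "word_act op 0 F = (\<lambda>a. 0)"
  by (simp add: word_act_def fun_eq_iff)

lemma word_act_uminus: "word_act op (- x) F = (\<lambda>a. - word_act op x F a)"
  by (simp add: word_act_def fun_eq_iff sum_negf)

lemma word_act_diff: "word_act op (x - y) F = (\<lambda>a. word_act op x F a - word_act op y F a)"
  using word_act_add[of op x "- y" F] by (simp add: word_act_uminus)

lemma word_act_single: "word_act op (Poly_Mapping.single w c) F = (\<lambda>a. c * foldr op (letters w) F a)"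
  by (cases "c = 0") (auto simp: word_act_def fun_eq_iff)

lemma word_act_scal: "word_act op (scal c) F = (\<lambda>a. c * F a)"
  by (simp add: scal_def word_act_single zero_fword_def)

lemma scal_one: "scal 1 = 1"
  by (simp add: scal_def single_one)

lemma word_act_one: "word_act op 1 F = F"
  using word_act_scal[of op 1 F] by (simp add: scal_one)

lemma word_act_gen: "word_act op (gen g) F = op g F"
  by (simp add: gen_def word_act_single)

lemma linear_op_foldr: "(\<And>g. linear_op (op g)) \<Longrightarrow> linear_op (foldr op ws)"
proof (induction ws)
  case Nil
  then show ?case by (simp add: linear_op_def)
next
  case (Cons g ws)
  then show ?case by (simp add: linear_op_def)
qed

lemma falg_single_induct [case_names single add zero]:
  fixes x :: "'g falg"
  assumes "\<And>w c. w \<in> Poly_Mapping.keys x \<Longrightarrow> P (Poly_Mapping.single w c)"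
    and "\<And>y z. P y \<Longrightarrow> P z \<Longrightarrow> P (y + z)" and "P 0"
  shows "P x"
proof -
  have "P (\<Sum>w\<in>S. Poly_Mapping.single w (Poly_Mapping.lookup x w))"
    if "S \<subseteq> Poly_Mapping.keys x" for S
    using finite_subset[OF that finite_keys] that
    by (induction S rule: finite_induct) (auto intro: assms)
  moreover have "(\<Sum>w\<in>Poly_Mapping.keys x. Poly_Mapping.single w (Poly_Mapping.lookup x w)) = x"
    by (rule poly_mapping_eqI) (simp add: lookup_sum lookup_single when_def in_keys_iff)
  ultimately show ?thesis
    using order_refl by metis
qed

text \<open>Linearity of the letters is what makes concatenation of words, extended bilinearly, act by composition.\<close>
lemma word_act_mult:
  assumes lin: "\<And>g. linear_op (op g)"
  shows "word_act op (x * y) F = word_act op x (word_act op y F)"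
proof (induction x rule: falg_single_induct)
  case (single w c)
  show ?case
  proof (induction y rule: falg_single_induct)
    case (single v d)
    then show ?case
      by (simp add: mult_single word_act_single plus_fword_def mult.assoc
          linear_op_scale[OF linear_op_foldr[of op, OF lin]])
  next
    case (add y z)
    then show ?case
      by (simp add: distrib_left word_act_add word_act_single
          linear_op_add[OF linear_op_foldr[of op, OF lin]])
  qed (simp add: word_act_zero word_act_single linear_op_zero[OF linear_op_foldr[of op, OF lin]])
qed (simp_all add: distrib_right word_act_add word_act_zero)

lemma linear_op_word_act:
  assumes lin: "\<And>g. linear_op (op g)"
  shows "linear_op (word_act op x)"
  by (simp add: linear_op_def word_act_def fun_eq_iff sum.distrib distrib_left sum_distrib_left
      linear_op_add[OF linear_op_foldr[of op, OF lin]]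
      linear_op_scale[OF linear_op_foldr[of op, OF lin]] mult.left_commute)

text \<open>The relative free algebra is generated by scalars and letters. This is the induction behind every
  reduction to generators.\<close>
lemma free_alg_induct [consumes 1, case_names scal gen add mult]:
  assumes x: "x \<in> carrier (free_alg G)"
    and scal: "\<And>c. P (scal c)" and gen: "\<And>g. g \<in> G \<Longrightarrow> P (gen g)"
    and add: "\<And>x y. x \<in> carrier (free_alg G) \<Longrightarrow> y \<in> carrier (free_alg G) \<Longrightarrow> P x \<Longrightarrow> P y \<Longrightarrow> P (x + y)"
    and mult: "\<And>x y. x \<in> carrier (free_alg G) \<Longrightarrow> y \<in> carrier (free_alg G) \<Longrightarrow> P x \<Longrightarrow> P y \<Longrightarrow> P (x * y)"
  shows "P x"
proof -
  have word: "Poly_Mapping.single (FWord ws) c \<in> carrier (free_alg G) \<and> P (Poly_Mapping.single (FWord ws) c)"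
    if "set ws \<subseteq> G" for ws c
    using that
  proof (induction ws)
    case Nil
    have "Poly_Mapping.single (FWord []) c = Defs.scal c" by (simp add: scal_def zero_fword_def)
    then show ?case using scal free_alg_scal_closed by metis
  next
    case (Cons g ws)
    have eq: "Poly_Mapping.single (FWord (g # ws)) c = Defs.gen g * Poly_Mapping.single (FWord ws) c"
      by (simp add: gen_def mult_single plus_fword_def)
    have "g \<in> G" and ws: "set ws \<subseteq> G" using Cons.prems by auto
    then have g: "Defs.gen g \<in> carrier (free_alg G)" by (simp only: free_alg_gen_closed)
    show ?case
      unfolding eq using Cons.IH[OF ws] g mult gen[OF \<open>g \<in> G\<close>] free_alg_mult_closed by blast
  qed
  have "x \<in> carrier (free_alg G) \<and> P x"
  proof (induction x rule: falg_single_induct)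
    case (single w c)
    then have "set (letters w) \<subseteq> G" using x by simp
    from word[OF this, of c] show ?case by simp
  next
    case (add y z)
    then show ?case using assms(4) free_alg_add_closed by blast
  next
    case zero
    have "scal 0 = (0 :: 'a falg)" by (simp add: scal_def)
    then show ?case using scal[of 0] by simp
  qed
  then show ?thesis ..
qed

lemma ideal_rel_ideal:
  assumes "snd P \<subseteq> carrier (free_alg (fst P))"
  shows "ideal (rel_ideal P) (free_alg (fst P))"
  unfolding rel_ideal_def by (rule ring.genideal_ideal[OF ring_free_alg assms])

lemma cls_ring_hom:
  assumes "snd P \<subseteq> carrier (free_alg (fst P))"
  shows "cls P \<in> ring_hom (free_alg (fst P)) (presented P)"
  using ideal.rcos_ring_hom[OF ideal_rel_ideal[OF assms]]
  unfolding presented_def cls_def[abs_def] by simp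

lemma presented_carrier: "carrier (presented P) = cls P ` carrier (free_alg (fst P))"
  by (auto simp: presented_def cls_def FactRing_def A_RCOSETS_def')

text \<open>The common action of all representatives of a coset; it is meaningful only when the letters respect
  the relations, which is the content of \<open>cls_act_cls\<close> below.\<close>
definition cls_act :: "('g \<Rightarrow> laurent \<Rightarrow> laurent) \<Rightarrow> 'g falg set \<Rightarrow> laurent \<Rightarrow> laurent" where
  "cls_act op U F = the_elem ((\<lambda>x. word_act op x F) ` U)"

text \<open>The elements that act by zero form a two-sided ideal, hence contain the ideal generated by the
  relators as soon as they contain the relators.\<close>
lemma rel_ideal_word_act:
  assumes lin: "\<And>g. linear_op (op g)"
    and closed: "snd P \<subseteq> carrier (free_alg (fst P))"
    and kill: "\<And>x F. x \<in> snd P \<Longrightarrow> word_act op x F = (\<lambda>a. 0)"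
    and x: "x \<in> rel_ideal P"
  shows "word_act op x F = (\<lambda>a. 0)"
proof -
  let ?R = "free_alg (fst P)"
  let ?J = "{x \<in> carrier ?R. \<forall>F. word_act op x F = (\<lambda>a. 0)}"
  have zero: "word_act op x (\<lambda>a. 0) = (\<lambda>a. 0)" for x
    by (rule linear_op_zero[OF linear_op_word_act[of op, OF lin]])
  have inv: "\<ominus>\<^bsub>?R\<^esub> x = - x" if "x \<in> carrier ?R" for x
    using that by (intro abelian_group.minus_equality[OF ring.is_abelian_group[OF ring_free_alg]])
      auto
  have "ideal ?J ?R"
  proof (rule idealI[OF ring_free_alg])
    show "subgroup ?J (add_monoid ?R)"
    proof (rule group.subgroupI)
      show "Group.group (add_monoid ?R)"
        by (rule abelian_group.a_group[OF ring.is_abelian_group[OF ring_free_alg]])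
      show "?J \<noteq> {}" using free_alg_zero_closed[of "fst P"] word_act_zero[of op] by blast
    next
      fix x assume "x \<in> ?J"
      then show "inv\<^bsub>add_monoid ?R\<^esub> x \<in> ?J"
        using inv[of x] by (auto simp: a_inv_def word_act_uminus)
    qed (use free_alg_add_closed[of _ "fst P"] in \<open>auto simp: word_act_add simp del: free_alg_simps(1)\<close>)
  qed (use free_alg_mult_closed[of _ "fst P"] in \<open>auto simp: word_act_mult[of op, OF lin] zero
      simp del: free_alg_simps(1)\<close>)
  then have "rel_ideal P \<subseteq> ?J"
    unfolding rel_ideal_def using closed kill
    by (intro ring.genideal_minimal[OF ring_free_alg]) (auto simp del: free_alg_simps(1))
  then show ?thesis using x by blast
qed

lemma mem_cls:
  assumes "y \<in> cls P x" obtains h where "h \<in> rel_ideal P" "y = h + x"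
  using assms by (auto simp: cls_def a_r_coset_def')

lemma cls_self:
  assumes "snd P \<subseteq> carrier (free_alg (fst P))"
  shows "x \<in> cls P x"
proof -
  have "0 \<in> rel_ideal P"
    using additive_subgroup.zero_closed[OF ideal.axioms(1)[OF ideal_rel_ideal[OF assms]]] by simp
  then show ?thesis by (force simp: cls_def a_r_coset_def')
qed

text \<open>A coset determines whether its representatives lie in the relative free algebra, because the ideal
  does. Values of an automorphism on generators are therefore automatically well formed.\<close>
lemma cls_carrier_imp:
  assumes closed: "snd P \<subseteq> carrier (free_alg (fst P))"
    and x: "cls P x \<in> carrier (presented P)"
  shows "x \<in> carrier (free_alg (fst P))"
proof -
  let ?R = "free_alg (fst P)"
  interpret I: ideal "rel_ideal P" ?R by (rule ideal_rel_ideal[OF closed])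
  obtain y where y: "y \<in> carrier ?R" "cls P x = cls P y" using x by (auto simp: presented_carrier simp
      del: free_alg_simps)
  have "x \<in> cls P x" by (rule cls_self[OF closed])
  then obtain h where "h \<in> rel_ideal P" "x = h + y" using y(2) by (auto elim: mem_cls)
  then show ?thesis using free_alg_add_closed[OF I.Icarr y(1)] by simp
qed

locale letter_rep =
  fixes P :: "'g presentation" and op :: "'g \<Rightarrow> laurent \<Rightarrow> laurent"
  assumes lin: "linear_op (op g)"
    and closed: "snd P \<subseteq> carrier (free_alg (fst P))"
    and kill: "x \<in> snd P \<Longrightarrow> word_act op x F = (\<lambda>a. 0)"
begin

lemma word_act_cls: "y \<in> cls P x \<Longrightarrow> word_act op y F = word_act op x F"
  using rel_ideal_word_act[OF lin closed kill] by (auto elim!: mem_cls simp: word_act_add)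

lemma cls_act_cls:
  assumes "x \<in> carrier (free_alg (fst P))"
  shows "cls_act op (cls P x) F = word_act op x F"
proof -
  have "(\<lambda>y. word_act op y F) ` cls P x = {word_act op x F}"
    using cls_self[OF closed] word_act_cls by blast
  then show ?thesis by (simp add: cls_act_def)
qed

lemma cls_act_mult:
  assumes "U \<in> carrier (presented P)" "V \<in> carrier (presented P)"
  shows "cls_act op (U \<otimes>\<^bsub>presented P\<^esub> V) F = cls_act op U (cls_act op V F)"
proof -
  obtain x y where xy: "x \<in> carrier (free_alg (fst P))" "y \<in> carrier (free_alg (fst P))"
    "U = cls P x" "V = cls P y" using assms by (auto simp: presented_carrier simp del: free_alg_simps)
  then have "U \<otimes>\<^bsub>presented P\<^esub> V = cls P (x * y)"
    using ring_hom_mult[OF cls_ring_hom[OF closed] xy(1,2)] by simp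
  then show ?thesis
    using xy free_alg_mult_closed[OF xy(1,2)] by (simp add: cls_act_cls word_act_mult[of op, OF lin]
        del: free_alg_simps)
qed

lemma cls_act_add:
  assumes "U \<in> carrier (presented P)" "V \<in> carrier (presented P)"
  shows "cls_act op (U \<oplus>\<^bsub>presented P\<^esub> V) F = (\<lambda>a. cls_act op U F a + cls_act op V F a)"
proof -
  obtain x y where xy: "x \<in> carrier (free_alg (fst P))" "y \<in> carrier (free_alg (fst P))"
    "U = cls P x" "V = cls P y" using assms by (auto simp: presented_carrier simp del: free_alg_simps)
  then have "U \<oplus>\<^bsub>presented P\<^esub> V = cls P (x + y)"
    using ring_hom_add[OF cls_ring_hom[OF closed] xy(1,2)] by simp
  then show ?thesis
    using xy free_alg_add_closed[OF xy(1,2)] by (simp add: cls_act_cls word_act_add del: free_alg_simps)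
qed

lemma cls_act_scal: "cls_act op (cls P (scal c)) F = (\<lambda>a. c * F a)"
  by (simp add: cls_act_cls[OF free_alg_scal_closed] word_act_scal)

text \<open>The reduction to generators: the elements \<open>x\<close> for which \<open>T\<close> intertwines the action of \<open>x\<close> with the
  action of \<open>\<psi>(x)\<close> form a subalgebra. With \<open>T\<close> the identity this also computes the pullback of a
  representation along a homomorphism from its values on generators.\<close>
lemma intertwine_extend:
  assumes closed': "snd Q \<subseteq> carrier (free_alg (fst Q))"
    and \<psi>: "\<psi> \<in> alg_hom Q P"
    and lin': "\<And>h. linear_op (op' h)" and T: "linear_op T"
    and gens: "\<And>h F. h \<in> fst Q \<Longrightarrow> T (op' h F) = cls_act op (\<psi> (cls Q (gen h))) (T F)"
    and x: "x \<in> carrier (free_alg (fst Q))"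
  shows "T (word_act op' x F) = cls_act op (\<psi> (cls Q x)) (T F)"
  using x
proof (induction x arbitrary: F rule: free_alg_induct)
  case (scal c)
  have "\<psi> (cls Q (scal c)) = cls P (scal c)" using \<psi> by (simp add: alg_hom_def)
  then show ?case by (simp add: word_act_scal cls_act_scal linear_op_scale[OF T])
next
  case (gen h)
  then show ?case by (simp add: word_act_gen gens)
next
  case (add x y)
  have \<psi>': "\<psi> \<in> ring_hom (presented Q) (presented P)" using \<psi> by (simp add: alg_hom_def)
  have c: "cls Q x \<in> carrier (presented Q)" "cls Q y \<in> carrier (presented Q)"
    using add.hyps by (auto simp: presented_carrier simp del: free_alg_simps)
  have "\<psi> (cls Q (x + y)) = \<psi> (cls Q x) \<oplus>\<^bsub>presented P\<^esub> \<psi> (cls Q y)"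
    using ring_hom_add[OF cls_ring_hom[OF closed'] add.hyps] ring_hom_add[OF \<psi>' c] by simp
  then show ?case
    using add.IH c by (simp add: word_act_add linear_op_add[OF T] cls_act_add ring_hom_closed[OF \<psi>'])
next
  case (mult x y)
  have \<psi>': "\<psi> \<in> ring_hom (presented Q) (presented P)" using \<psi> by (simp add: alg_hom_def)
  have c: "cls Q x \<in> carrier (presented Q)" "cls Q y \<in> carrier (presented Q)"
    using mult.hyps by (auto simp: presented_carrier simp del: free_alg_simps)
  have "\<psi> (cls Q (x * y)) = \<psi> (cls Q x) \<otimes>\<^bsub>presented P\<^esub> \<psi> (cls Q y)"
    using ring_hom_mult[OF cls_ring_hom[OF closed'] mult.hyps] ring_hom_mult[OF \<psi>' c] by simp
  then show ?case
    using mult.IH c by (simp add: word_act_mult[of op', OF lin'] cls_act_mult ring_hom_closed[OF \<psi>'])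
qed

end

lemma alg_hom_comp: "\<tau> \<in> alg_hom P Q \<Longrightarrow> \<phi> \<in> alg_hom Q R \<Longrightarrow> (\<lambda>U. \<phi> (\<tau> U)) \<in> alg_hom P R"
  using ring_hom_trans[of \<tau> _ _ \<phi>] by (auto simp: alg_hom_def comp_def)

section \<open>The \<open>q\<close>-Weyl algebra on functions of integral exponents\<close>

lemma q_nonzero [simp]: "q \<noteq> 0"
  by (simp add: q_def Fract_def[symmetric] eq_fract Zero_fract_def)

lemma q_squared_neq_one: "q * q \<noteq> 1"
proof
  assume "q * q = 1"
  then have "[:0, 1:] * [:0, 1:] = (1 :: rat poly)"
    by (simp add: q_def eq_fract One_fract_def)
  then show False by (simp add: one_pCons)
qed

lemma q_minus_inverse [simp]: "q - inverse q \<noteq> 0"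
  using q_squared_neq_one by (simp add: field_simps)

lemma qint_zero [simp]: "qint 0 = 0"
  by (simp add: qint_def)

text \<open>The coefficient of \<open>X\<^sup>a\<close> in \<open>\<dd>\<^sub>i F\<close> comes from the exponent \<open>a + e\<^sub>i\<close>, and in \<open>\<xx>\<^sub>i F\<close> from \<open>a - e\<^sub>i\<close>.\<close>
fun weyl_op :: "nat \<Rightarrow> nat \<Rightarrow> wgen \<Rightarrow> laurent \<Rightarrow> laurent" where
  "weyl_op r n (GD i) F a = qint (int (cc r n i) * (a i + 1)) * F (a(i := a i + 1))"
| "weyl_op r n (GX i) F a = F (a(i := a i - 1))"
| "weyl_op r n (GM i) F a = q powi (int (cc r n i) * a i) * F a"
| "weyl_op r n (GMinv i) F a = q powi (- (int (cc r n i) * a i)) * F a"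

lemma linear_op_weyl_op: "linear_op (weyl_op r n g)"
  by (cases g) (auto simp: linear_op_def fun_eq_iff algebra_simps)

text \<open>The relations hold at every integral exponent vector, since they are identities between powers of \<open>q\<close>
  that do not depend on the sign of the exponents.\<close>
lemma weyl_op_kills_Aq_rels:
  assumes "x \<in> Aq_rels r n"
  shows "word_act (weyl_op r n) x F = (\<lambda>a. 0)"
proof -
  note w = word_act_diff word_act_mult[of "weyl_op r n", OF linear_op_weyl_op]
      word_act_one word_act_scal word_act_gen
  \<comment> \<open>Naming the inverse keeps it atomic, so that ring normalisation suffices.\<close>
  obtain d where d: "inverse (q - inverse q) = d" by blast
  have qint_eq: "qint k = d * (q powi k - q powi (- k))" for k
    by (simp add: qint_def d[symmetric] field_simps)
  have single: "\<forall>x\<in>{Mw i * Minvw i - 1, Minvw i * Mw i - 1,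
        Dw i * Mw i - scal (q powi int (cc r n i)) * Mw i * Dw i,
        Xw i * Mw i - scal (q powi (- int (cc r n i))) * Mw i * Xw i,
        Dw i * Xw i - scal (inverse (q - inverse q)) *
          (scal (q powi int (cc r n i)) * Mw i - scal (q powi (- int (cc r n i))) * Minvw i),
        Xw i * Dw i - scal (inverse (q - inverse q)) * (Mw i - Minvw i)}.
      word_act (weyl_op r n) x F a = 0" for i a
  proof -
    define c where "c = int (cc r n i)"
    obtain A A' C C' where AC: "q powi (c * a i) = A" "q powi (- (c * a i)) = A'"
        "q powi c = C" "q powi (- c) = C'" and inv: "A * A' = 1" "C * C' = 1"
      by (auto simp: power_int_minus)
    have shift: "q powi (c * (a i + 1)) = A * C" "q powi (- (c * (a i + 1))) = A' * C'"
        "q powi (c * (a i - 1)) = A * C'"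
      unfolding AC[symmetric] power_int_add[symmetric, OF disjI1[OF q_nonzero]]
      by (simp_all add: algebra_simps)
    show ?thesis
      unfolding c_def[symmetric]
      by (simp add: w qint_eq d c_def[symmetric] shift AC del: power_int_of_nat)
        (use inv in \<open>auto simp: algebra_simps\<close>)
  qed
  have commute:
    "word_act (weyl_op r n) (Mw i * Mw j - Mw j * Mw i) F = (\<lambda>a. 0)"
    "word_act (weyl_op r n) (Dw i * Dw j - Dw j * Dw i) F = (\<lambda>a. 0)"
    "word_act (weyl_op r n) (Xw i * Xw j - Xw j * Xw i) F = (\<lambda>a. 0)" for i j
    by (cases "i = j"; simp add: w word_act_zero fun_upd_twist[of i j] mult.left_commute)+
  have mixed:
    "word_act (weyl_op r n) (Dw i * Mw j - Mw j * Dw i) F = (\<lambda>a. 0)"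
    "word_act (weyl_op r n) (Xw i * Mw j - Mw j * Xw i) F = (\<lambda>a. 0)"
    "word_act (weyl_op r n) (Dw i * Xw j - Xw j * Dw i) F = (\<lambda>a. 0)" if "j \<noteq> i" for i j
    using that by (simp_all add: w fun_upd_twist[of i j])
  show ?thesis
    using assms unfolding Aq_rels_def
    by (elim UnE UN_E insertE emptyE DiffE; hypsubst)
      ((rule ext, rule single[rule_format], blast) | (rule commute mixed; blast))+
qed

lemma letter_rep_weyl_op: "letter_rep (Aq r n) (weyl_op r n)"
  using linear_op_weyl_op weyl_op_kills_Aq_rels Aq_rels_closed
  by unfold_locales (auto simp: Aq_def simp del: free_alg_simps(1))

definition expo_vec :: "expo \<Rightarrow> nat \<Rightarrow> int" where
  "expo_vec b = (\<lambda>i. ex b i)"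

text \<open>The coefficient family of a polynomial, extended by zero to integral vectors that are not exponents of
  monomials.\<close>
definition coeff_fun :: "qpoly \<Rightarrow> laurent" where
  "coeff_fun f a = (\<Sum>b\<in>Poly_Mapping.keys f. Poly_Mapping.lookup f b * of_bool (expo_vec b = a))"

lemma expo_vec_eq_iff [simp]: "expo_vec b = expo_vec c \<longleftrightarrow> b = c"
  by (auto simp: expo_vec_def fun_eq_iff intro: poly_mapping_eqI)

lemma coeff_fun_expo_vec: "coeff_fun f (expo_vec b) = Poly_Mapping.lookup f b"
  by (auto simp: coeff_fun_def of_bool_def in_keys_iff sum.delta' if_distrib cong: if_cong)

lemma coeff_fun_inject: "coeff_fun f = coeff_fun g \<Longrightarrow> f = g"
  by (rule poly_mapping_eqI) (metis coeff_fun_expo_vec)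

lemma coeff_fun_outside: "a \<notin> range expo_vec \<Longrightarrow> coeff_fun f a = 0"
  unfolding coeff_fun_def by (rule sum.neutral) auto

lemma lookup_scal_mult: "Poly_Mapping.lookup (scal c * f) b = c * Poly_Mapping.lookup f b"
  for f :: qpoly
  by (simp add: scal_def mult_map_scale_conv_mult[symmetric] map.rep_eq when_def)

lemma coeff_fun_add: "coeff_fun (f + g) = (\<lambda>a. coeff_fun f a + coeff_fun g a)"
proof
  fix a show "coeff_fun (f + g) a = coeff_fun f a + coeff_fun g a"
    by (cases "a \<in> range expo_vec") (auto simp: coeff_fun_expo_vec coeff_fun_outside lookup_add)
qed

lemma coeff_fun_zero: "coeff_fun 0 = (\<lambda>a. 0)"
  by (simp add: coeff_fun_def fun_eq_iff)

lemma coeff_fun_scal: "coeff_fun (scal c * f) = (\<lambda>a. c * coeff_fun f a)"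
proof
  fix a show "coeff_fun (scal c * f) a = c * coeff_fun f a"
    by (cases "a \<in> range expo_vec") (auto simp: coeff_fun_expo_vec coeff_fun_outside lookup_scal_mult)
qed

lemma coeff_fun_sum: "coeff_fun (\<Sum>i\<in>I. f i) = (\<lambda>a. \<Sum>i\<in>I. coeff_fun (f i) a)"
  by (induction I rule: infinite_finite_induct) (simp_all add: coeff_fun_add coeff_fun_zero)

lemma coeff_fun_Xmon: "coeff_fun (Xmon b) a = of_bool (expo_vec b = a)"
  by (simp add: coeff_fun_def)

lemma coeff_fun_lin_ext:
  assumes T: "linear_op T" and mon: "\<And>b. coeff_fun (g b) = T (\<lambda>a. of_bool (expo_vec b = a))"
  shows "coeff_fun (lin_ext g f) = T (coeff_fun f)"
proof -
  have f: "coeff_fun f = (\<lambda>a. \<Sum>b\<in>Poly_Mapping.keys f. Poly_Mapping.lookup f b * of_bool (expo_vec b = a))"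
    by (rule ext) (rule coeff_fun_def)
  have "coeff_fun (lin_ext g f) = (\<lambda>a. \<Sum>b\<in>Poly_Mapping.keys f.
      Poly_Mapping.lookup f b * T (\<lambda>a. of_bool (expo_vec b = a)) a)"
    by (simp only: lin_ext_def coeff_fun_sum coeff_fun_scal mon)
  also have "\<dots> = T (coeff_fun f)"
    unfolding f by (rule linear_op_sum[OF T, symmetric])
  finally show ?thesis .
qed

text \<open>The embedding commutes with the generators. For the derivative this uses \<open>[0] = 0\<close>: the coefficient
  at an exponent vector with entry \<open>-1\<close> receives \<open>[0]\<close> times a coefficient of the polynomial.\<close>
lemma coeff_fun_gen_op: "coeff_fun (gen_op r n g f) = weyl_op r n g (coeff_fun f)"
proof (cases g)
  case (GD i)
  show ?thesis unfolding GD gen_op.simps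
  proof (rule coeff_fun_lin_ext[OF linear_op_weyl_op], rule ext)
    fix b a
    have "expo_vec (b - unit_expo i) = a \<longleftrightarrow> expo_vec b = a(i := a i + 1)" if "ex b i \<noteq> 0"
      using that by (force simp: expo_vec_def fun_eq_iff lookup_minus lookup_single when_def of_nat_diff)
    moreover have "a i + 1 = ex b i" if "expo_vec b = a(i := a i + 1)"
      using fun_cong[OF that, of i] by (simp add: expo_vec_def)
    ultimately show "coeff_fun (if ex b i = 0 then 0
         else scal (qint (int (cc r n i) * ex b i)) * Xmon (b - unit_expo i)) a
       = weyl_op r n (GD i) (\<lambda>a. of_bool (expo_vec b = a)) a"
      by (auto simp: coeff_fun_scal coeff_fun_zero coeff_fun_Xmon)
  qed
next
  case (GX i)
  show ?thesis unfolding GX gen_op.simps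
  proof (rule coeff_fun_lin_ext[OF linear_op_weyl_op], rule ext)
    fix b a
    have "expo_vec (b + unit_expo i) = a \<longleftrightarrow> expo_vec b = a(i := a i - 1)"
      by (force simp: expo_vec_def fun_eq_iff lookup_add lookup_single when_def)
    then show "coeff_fun (Xmon (b + unit_expo i)) a = weyl_op r n (GX i) (\<lambda>a. of_bool (expo_vec b = a)) a"
      by (simp add: coeff_fun_Xmon)
  qed
next
  case (GM i)
  show ?thesis unfolding GM gen_op.simps
  proof (rule coeff_fun_lin_ext[OF linear_op_weyl_op], rule ext)
    fix b a
    have "a i = ex b i" if "expo_vec b = a"
      using fun_cong[OF that, of i] by (simp add: expo_vec_def)
    then show "coeff_fun (scal (q powi (int (cc r n i) * ex b i)) * Xmon b) a
        = weyl_op r n (GM i) (\<lambda>a. of_bool (expo_vec b = a)) a"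
      by (cases "expo_vec b = a") (simp_all add: coeff_fun_scal coeff_fun_Xmon)
  qed
next
  case (GMinv i)
  show ?thesis unfolding GMinv gen_op.simps
  proof (rule coeff_fun_lin_ext[OF linear_op_weyl_op], rule ext)
    fix b a
    have "a i = ex b i" if "expo_vec b = a"
      using fun_cong[OF that, of i] by (simp add: expo_vec_def)
    then show "coeff_fun (scal (q powi (- (int (cc r n i) * ex b i))) * Xmon b) a
        = weyl_op r n (GMinv i) (\<lambda>a. of_bool (expo_vec b = a)) a"
      by (cases "expo_vec b = a") (simp_all add: coeff_fun_scal coeff_fun_Xmon)
  qed
qed

lemma coeff_fun_free_act: "coeff_fun (free_act r n x f) = word_act (weyl_op r n) x (coeff_fun f)"
proof -
  have "coeff_fun (foldr (gen_op r n) ws f) = foldr (weyl_op r n) ws (coeff_fun f)" for ws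
    by (induction ws) (simp_all add: coeff_fun_gen_op)
  then show ?thesis
    by (simp add: free_act_def word_act_def[abs_def] coeff_fun_sum coeff_fun_scal)
qed

lemma coeff_fun_weyl_act:
  assumes "U \<in> carrier (presented (Aq r n))"
  shows "coeff_fun (weyl_act r n U f) = cls_act (weyl_op r n) U (coeff_fun f)"
proof -
  interpret letter_rep "Aq r n" "weyl_op r n" by (rule letter_rep_weyl_op)
  obtain x where x: "x \<in> carrier (free_alg (fst (Aq r n)))" "U = cls (Aq r n) x"
    using assms by (auto simp: presented_carrier simp del: free_alg_simps)
  have "free_act r n y f = free_act r n x f" if "y \<in> U" for y
    using word_act_cls[of y x "coeff_fun f"] that x(2)
    by (intro coeff_fun_inject) (simp add: coeff_fun_free_act)
  then have "(\<lambda>y. free_act r n y f) ` U = {free_act r n x f}"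
    using cls_self[OF closed] x(2) by blast
  then show ?thesis
    by (simp add: weyl_act_def x(2) cls_act_cls[OF x(1)] coeff_fun_free_act)
qed

definition swap_vec :: "nat \<Rightarrow> (nat \<Rightarrow> int) \<Rightarrow> nat \<Rightarrow> int" where
  "swap_vec i a = a(i := a (i + 1), i + 1 := a i)"

lemma swap_vec_at: "swap_vec i a i = a (i + 1)" "swap_vec i a (i + 1) = a i" "swap_vec i a (Suc i) = a i"
  by (simp_all add: swap_vec_def)

text \<open>The operators \<open>\<T>'\<close> and \<open>\<T>''\<close> in terms of coefficients. In the case \<open>i < N\<close> the coefficient of \<open>X\<^sup>a\<close>
  comes from the swapped vector, so \<open>a\<^sub>i\<close> and \<open>a\<^bsub>i+1\<^esub>\<close> appear in exchanged roles.\<close>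
definition T1_op :: "nat \<Rightarrow> nat \<Rightarrow> int \<Rightarrow> nat \<Rightarrow> laurent \<Rightarrow> laurent" where
  "T1_op r n e i F a =
     (if i < Nr n then
        (- (q powi (- e))) powi (- a i) * q powi (e * a (i + 1) * a i) * F (swap_vec i a)
      else if n = 2 * r then
        q powi ((e * (a r)\<^sup>2 + 3 * e * a r) div 2 - e * a (r + 1) + 2 * e * a r * a (r + 1)) * F a
      else q powi ((e * (a (r + 1))\<^sup>2 - e * a (r + 1)) div 2) * F a)"

definition T2_op :: "nat \<Rightarrow> nat \<Rightarrow> int \<Rightarrow> nat \<Rightarrow> laurent \<Rightarrow> laurent" where
  "T2_op r n e i F a =
     (if i < Nr n then
        (- (q powi (- e))) powi (a (i + 1)) * q powi (- (e * a (i + 1) * a i)) * F (swap_vec i a)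
      else if n = 2 * r then
        q powi ((- (e * (a r)\<^sup>2) - 3 * e * a r) div 2 + e * a (r + 1) - 2 * e * a r * a (r + 1)) * F a
      else q powi ((- (e * (a (r + 1))\<^sup>2) + e * a (r + 1)) div 2) * F a)"

lemma linear_op_T1_op: "linear_op (T1_op r n e i)"
  by (simp add: linear_op_def T1_op_def fun_eq_iff algebra_simps)

lemma linear_op_T2_op: "linear_op (T2_op r n e i)"
  by (simp add: linear_op_def T2_op_def fun_eq_iff algebra_simps)

lemma expo_vec_swap: "expo_vec (swap_expo i b) = a \<longleftrightarrow> expo_vec b = swap_vec i a"
proof -
  have "expo_vec (swap_expo i b) = swap_vec i (expo_vec b)"
    by (auto simp: expo_vec_def swap_expo_def swap_vec_def fun_eq_iff Transposition.transpose_def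
        map_key.rep_eq inj_transpose)
  moreover have "swap_vec i (swap_vec i c) = c" for c by (auto simp: swap_vec_def fun_eq_iff)
  ultimately show ?thesis by metis
qed

lemma coeff_fun_T1: "coeff_fun (T1 r n e i f) = T1_op r n e i (coeff_fun f)"
  unfolding T1_def
proof (rule coeff_fun_lin_ext[OF linear_op_T1_op], rule ext)
  fix b a
  have ex: "ex b j = swap_vec i a j" if "expo_vec b = swap_vec i a" for j
    using fun_cong[OF that, of j] by (simp add: expo_vec_def)
  have ex': "ex b j = a j" if "expo_vec b = a" for j
    using that by (auto simp: expo_vec_def)
  show "coeff_fun (if i < Nr n then
       scal ((- (q powi (- e))) powi (- ex b (i + 1)) * q powi (e * ex b i * ex b (i + 1)))
         * Xmon (swap_expo i b)
     else if n = 2 * r then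
       scal (q powi ((e * (ex b r)\<^sup>2 + 3 * e * ex b r) div 2
                     - e * ex b (r + 1) + 2 * e * ex b r * ex b (r + 1))) * Xmon b
     else
       scal (q powi ((e * (ex b (r + 1))\<^sup>2 - e * ex b (r + 1)) div 2)) * Xmon b) a
     = T1_op r n e i (\<lambda>a. of_bool (expo_vec b = a)) a"
  proof (cases "i < Nr n")
    case True
    then show ?thesis
      by (cases "expo_vec b = swap_vec i a")
        (simp_all add: T1_op_def coeff_fun_scal coeff_fun_Xmon expo_vec_swap ex swap_vec_at
          del: power_int_of_nat)
  next
    case False
    then show ?thesis
      by (cases "expo_vec b = a") (simp_all add: T1_op_def coeff_fun_scal coeff_fun_Xmon ex')
  qed
qed

lemma coeff_fun_T2: "coeff_fun (T2 r n e i f) = T2_op r n e i (coeff_fun f)"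
  unfolding T2_def
proof (rule coeff_fun_lin_ext[OF linear_op_T2_op], rule ext)
  fix b a
  have ex: "ex b j = swap_vec i a j" if "expo_vec b = swap_vec i a" for j
    using fun_cong[OF that, of j] by (simp add: expo_vec_def)
  have ex': "ex b j = a j" if "expo_vec b = a" for j
    using that by (auto simp: expo_vec_def)
  show "coeff_fun (if i < Nr n then
       scal ((- (q powi (- e))) powi (ex b i) * q powi (- (e * ex b i * ex b (i + 1))))
         * Xmon (swap_expo i b)
     else if n = 2 * r then
       scal (q powi ((- (e * (ex b r)\<^sup>2) - 3 * e * ex b r) div 2
                     + e * ex b (r + 1) - 2 * e * ex b r * ex b (r + 1))) * Xmon b
     else
       scal (q powi ((- (e * (ex b (r + 1))\<^sup>2) + e * ex b (r + 1)) div 2)) * Xmon b) a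
     = T2_op r n e i (\<lambda>a. of_bool (expo_vec b = a)) a"
  proof (cases "i < Nr n")
    case True
    then show ?thesis
      by (cases "expo_vec b = swap_vec i a")
        (simp_all add: T2_op_def coeff_fun_scal coeff_fun_Xmon expo_vec_swap ex swap_vec_at
          del: power_int_of_nat)
  next
    case False
    then show ?thesis
      by (cases "expo_vec b = a") (simp_all add: T2_op_def coeff_fun_scal coeff_fun_Xmon ex')
  qed
qed

section \<open>Generator identities\<close>

text \<open>The images of the generators under \<open>\<phi>\<close>, as operators on coefficient families: \<open>\<xx>\<^bsub>p+1\<^esub> \<dd>\<^sub>p\<close> for \<open>B\<^sub>p\<close>,
  \<open>\<xx>\<^sub>p \<dd>\<^bsub>p+1\<^esub>\<close> for the mirror generator with \<open>c = c\<^bsub>p+1\<^esub>\<close>, and \<open>\<xx>\<^sub>p \<dd>\<^sub>p\<close> for the generator fixed by \<open>\<rho>\<^sub>n\<close>.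
  They play the part of Chevalley generators \<open>E\<close>, \<open>F\<close> and of a diagonal element.\<close>
definition E_op :: "nat \<Rightarrow> laurent \<Rightarrow> laurent" where
  "E_op p F a = qint (a p + 1) * F (a(p := a p + 1, Suc p := a (Suc p) - 1))"

definition F_op :: "int \<Rightarrow> nat \<Rightarrow> laurent \<Rightarrow> laurent" where
  "F_op c p F a = qint (c * (a (Suc p) + 1)) * F (a(p := a p - 1, Suc p := a (Suc p) + 1))"

definition H_op :: "nat \<Rightarrow> laurent \<Rightarrow> laurent" where
  "H_op p F a = qint (a p) * F a"

definition diag_op :: "qfield \<Rightarrow> ((nat \<Rightarrow> int) \<Rightarrow> int) \<Rightarrow> laurent \<Rightarrow> laurent" where
  "diag_op Q w F a = Q powi w a * F a"

definition op_qbr :: "qfield \<Rightarrow> (laurent \<Rightarrow> laurent) \<Rightarrow> (laurent \<Rightarrow> laurent) \<Rightarrow> laurent \<Rightarrow> laurent" where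
  "op_qbr c S R F a = S (R F) a - c * R (S F) a"

text \<open>The coefficients of \<open>\<T>'\<close> and \<open>\<T>''\<close> with \<open>Q = q\<^sup>e\<close>, at exponents \<open>x\<close> and \<open>y\<close> of the two variables that
  are involved. Products \<open>x y\<close> stay hidden inside these functions: only their behaviour under shifts
  matters, and it is governed by powers of \<open>Q\<close> that are linear in the exponents.\<close>
definition braid1_coeff :: "qfield \<Rightarrow> int \<Rightarrow> int \<Rightarrow> qfield" where
  "braid1_coeff Q x y = (- inverse Q) powi (- x) * Q powi (x * y)"

definition braid2_coeff :: "qfield \<Rightarrow> int \<Rightarrow> int \<Rightarrow> qfield" where
  "braid2_coeff Q x y = (- inverse Q) powi y * Q powi (- (x * y))"

definition even_exponent :: "int \<Rightarrow> int \<Rightarrow> int" where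
  "even_exponent x y = (x * x + 3 * x) div 2 - y + 2 * x * y"

definition odd_exponent :: "int \<Rightarrow> int" where
  "odd_exponent y = (y * y - y) div 2"

definition braid1 :: "qfield \<Rightarrow> nat \<Rightarrow> laurent \<Rightarrow> laurent" where
  "braid1 Q i F a = braid1_coeff Q (a i) (a (Suc i)) * F (swap_vec i a)"

definition braid2 :: "qfield \<Rightarrow> nat \<Rightarrow> laurent \<Rightarrow> laurent" where
  "braid2 Q i F a = braid2_coeff Q (a i) (a (Suc i)) * F (swap_vec i a)"

definition even_tip1 :: "qfield \<Rightarrow> nat \<Rightarrow> laurent \<Rightarrow> laurent" where
  "even_tip1 Q i F a = Q powi (even_exponent (a i) (a (Suc i))) * F a"

definition even_tip2 :: "qfield \<Rightarrow> nat \<Rightarrow> laurent \<Rightarrow> laurent" where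
  "even_tip2 Q i F a = Q powi (- even_exponent (a i) (a (Suc i))) * F a"

definition odd_tip1 :: "qfield \<Rightarrow> nat \<Rightarrow> laurent \<Rightarrow> laurent" where
  "odd_tip1 Q i F a = Q powi (odd_exponent (a i)) * F a"

definition odd_tip2 :: "qfield \<Rightarrow> nat \<Rightarrow> laurent \<Rightarrow> laurent" where
  "odd_tip2 Q i F a = Q powi (- odd_exponent (a i)) * F a"

text \<open>A normal form for updates at up to three consecutive indices: sorted by index, without idle updates.
  The rules are oriented, which a general exchange of updates could not be. The last one gives the
  entries themselves a common form.\<close>
lemma fun_upd_sort:
  "a(Suc i := y, i := x) = a(i := x, Suc i := y)"
  "a(Suc (Suc i) := z, i := x) = a(i := x, Suc (Suc i) := z)"
  "a(i := x, Suc i := a (Suc i)) = a(i := x)"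
  "a(i := x, Suc (Suc i) := a (Suc (Suc i))) = a(i := x)"
  "a(i := x, Suc i := y, Suc (Suc i) := a (Suc (Suc i))) = a(i := x, Suc i := y)"
  "1 + a i = a i + 1"
  for a :: "nat \<Rightarrow> int"
  by (auto simp: fun_eq_iff)

text \<open>A unit shift changes the numerator of the halved term by an even number, so the division by two
  passes to the change.\<close>
lemma even_exponent_shift:
  "even_exponent (x + 1) y = even_exponent x y + x + 2 + 2 * y"
  "even_exponent (x - 1) y = even_exponent x y - x - 1 - 2 * y"
  "even_exponent x (y + 1) = even_exponent x y - 1 + 2 * x"
  "even_exponent x (y - 1) = even_exponent x y + 1 - 2 * x"
proof -
  have "((x + 1) * (x + 1) + 3 * (x + 1)) div 2 = ((x * x + 3 * x) + 2 * (x + 2)) div 2"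
    "((x - 1) * (x - 1) + 3 * (x - 1)) div 2 = ((x * x + 3 * x) + 2 * (- x - 1)) div 2"
    by (simp_all add: algebra_simps)
  then show "even_exponent (x + 1) y = even_exponent x y + x + 2 + 2 * y"
    "even_exponent (x - 1) y = even_exponent x y - x - 1 - 2 * y"
    by (simp_all only: even_exponent_def div_mult_self2) (simp_all add: algebra_simps)
qed (simp_all add: even_exponent_def algebra_simps)

lemma odd_exponent_shift:
  "odd_exponent (y + 1) = odd_exponent y + y"
  "odd_exponent (y - 1) = odd_exponent y - y + 1"
proof -
  have "((y + 1) * (y + 1) - (y + 1)) div 2 = ((y * y - y) + 2 * y) div 2"
    "((y - 1) * (y - 1) - (y - 1)) div 2 = ((y * y - y) + 2 * (1 - y)) div 2"
    by (simp_all add: algebra_simps)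
  then show "odd_exponent (y + 1) = odd_exponent y + y" "odd_exponent (y - 1) = odd_exponent y - y + 1"
    by (simp_all add: odd_exponent_def)
qed

text \<open>\<open>Q\<close> stands for \<open>q\<close> or \<open>q\<^sup>-\<^sup>1\<close>. The number \<open>d\<close> names the inverse of \<open>Q - Q\<^sup>-\<^sup>1\<close> in the quantum integers, which
  keeps the identities polynomial.\<close>
locale q_param =
  fixes Q d :: qfield
  assumes Q: "Q \<noteq> 0" and d: "d * (Q - inverse Q) = 1"
    and qint: "qint k = d * (Q powi k - inverse (Q powi k))"
begin

lemma Qpow: "Q powi (x + y) = Q powi x * Q powi y" "Q powi (x - y) = Q powi x * inverse (Q powi y)"
  "Q powi (- x) = inverse (Q powi x)" "Q powi (2 * x) = Q powi x * Q powi x"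
  unfolding mult_2 using Q
      by (simp_all only: power_int_add power_int_diff power_int_minus divide_inverse simp_thms)

text \<open>These rules are switched off in the calculations below: most of them turn an equation of products into
  a disjunction, and the last one would undo \<open>inverse_Q_power\<close>.\<close>
lemmas cancel_rules = mult_cancel_left mult_cancel_right mult_eq_0_iff neg_equal_iff_equal power_inverse

lemma inverse_Q_power: "inverse (Q ^ k) = inverse Q ^ k"
  by (simp add: power_inverse)

lemma braid1_coeff_shift:
  "braid1_coeff Q (x + 1) y = - (Q * Q powi y * braid1_coeff Q x y)"
  "braid1_coeff Q (x - 1) y = - (inverse Q * inverse (Q powi y) * braid1_coeff Q x y)"
  "braid1_coeff Q x (y + 1) = Q powi x * braid1_coeff Q x y"
  "braid1_coeff Q x (y - 1) = inverse (Q powi x) * braid1_coeff Q x y"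
  using Q by (simp_all add: braid1_coeff_def power_int_add power_int_diff power_int_minus
    ring_distribs divide_inverse mult_ac)

lemma braid2_coeff_shift:
  "braid2_coeff Q x (y + 1) = - (inverse Q * inverse (Q powi x) * braid2_coeff Q x y)"
  "braid2_coeff Q x (y - 1) = - (Q * Q powi x * braid2_coeff Q x y)"
  "braid2_coeff Q (x + 1) y = inverse (Q powi y) * braid2_coeff Q x y"
  "braid2_coeff Q (x - 1) y = Q powi y * braid2_coeff Q x y"
  using Q by (simp_all add: braid2_coeff_def power_int_add power_int_diff power_int_minus
    ring_distribs divide_inverse mult_ac)

lemmas op_defs = E_op_def F_op_def H_op_def diag_op_def op_qbr_def swap_vec_def
  braid1_def braid2_def even_tip1_def even_tip2_def odd_tip1_def odd_tip2_def

lemmas shift_rules = fun_upd_sort braid1_coeff_shift braid2_coeff_shift even_exponent_shift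
  odd_exponent_shift Qpow qint inverse_Q_power

lemma Qinv: "Q * inverse Q = 1" "Q powi x * inverse (Q powi x) = 1"
  using Q by simp_all

text \<open>The braidings against the generators at the index itself, at the two neighbouring indices, and, for
  odd \<open>n\<close>, at the fixed point of \<open>\<rho>\<^sub>n\<close>. In each proof the simplifier brings both sides to multiples of the same
  shifted value of \<open>F\<close>; the relations \<open>Q Q\<^sup>-\<^sup>1 = 1\<close>, \<open>Q\<^sup>x Q\<^sup>-\<^sup>x = 1\<close> and \<open>d (Q - Q\<^sup>-\<^sup>1) = 1\<close> then decide the
  equality of the coefficients. When one factor is common, the simplifier turns the equation into a
  disjunction whose last member is the equation of the remaining factors.\<close>

lemma braid1_E: "braid1 Q i (E_op i F)
    = (\<lambda>a. - F_op 1 i (diag_op Q (\<lambda>a. a (Suc i) - a i) (braid1 Q i F)) a)"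
proof
  fix a
  show "braid1 Q i (E_op i F) a
    = - F_op 1 i (diag_op Q (\<lambda>a. a (Suc i) - a i) (braid1 Q i F)) a"
    by (simp add: op_defs shift_rules Q del: cancel_rules)
      (use Qinv(1) Qinv(2)[of "a i"] Qinv(2)[of "a (Suc i)"] d
       in \<open>(intro disjI2)?; Groebner_Basis.algebra\<close>)
qed

lemma braid1_F: "braid1 Q i (F_op 1 i F)
    = (\<lambda>a. - diag_op Q (\<lambda>a. a i - a (Suc i)) (E_op i (braid1 Q i F)) a)"
proof
  fix a
  show "braid1 Q i (F_op 1 i F) a
    = - diag_op Q (\<lambda>a. a i - a (Suc i)) (E_op i (braid1 Q i F)) a"
    by (simp add: op_defs shift_rules Q del: cancel_rules)
      (use Qinv(1) Qinv(2)[of "a i"] Qinv(2)[of "a (Suc i)"] d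
       in \<open>(intro disjI2)?; Groebner_Basis.algebra\<close>)
qed

lemma braid1_E_above: "braid1 Q i (E_op (Suc i) F)
    = op_qbr (inverse Q) (E_op i) (E_op (Suc i)) (braid1 Q i F)"
proof
  fix a
  show "braid1 Q i (E_op (Suc i) F) a
    = op_qbr (inverse Q) (E_op i) (E_op (Suc i)) (braid1 Q i F) a"
    by (simp add: op_defs shift_rules Q del: cancel_rules)
      (use Qinv(1) Qinv(2)[of "a i"] Qinv(2)[of "a (Suc i)"] d
       in \<open>(intro disjI2)?; Groebner_Basis.algebra\<close>)
qed

lemma braid1_F_above: "braid1 Q i (F_op c (Suc i) F)
    = op_qbr Q (F_op c (Suc i)) (F_op 1 i) (braid1 Q i F)"
proof
  fix a
  show "braid1 Q i (F_op c (Suc i) F) a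
    = op_qbr Q (F_op c (Suc i)) (F_op 1 i) (braid1 Q i F) a"
    by (simp add: op_defs shift_rules Q del: cancel_rules)
      (use Qinv(1) Qinv(2)[of "a i"] Qinv(2)[of "a (Suc i)"] d
       in \<open>(intro disjI2)?; Groebner_Basis.algebra\<close>)
qed

lemma braid1_E_below: "braid1 Q (Suc i) (E_op i F)
    = op_qbr (inverse Q) (E_op (Suc i)) (E_op i) (braid1 Q (Suc i) F)"
proof
  fix a
  show "braid1 Q (Suc i) (E_op i F) a
    = op_qbr (inverse Q) (E_op (Suc i)) (E_op i) (braid1 Q (Suc i) F) a"
    by (simp add: op_defs shift_rules Q del: cancel_rules)
      (use Qinv(1) Qinv(2)[of "a (Suc i)"] Qinv(2)[of "a (Suc (Suc i))"] d
       in \<open>(intro disjI2)?; Groebner_Basis.algebra\<close>)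
qed

lemma braid1_F_below: "braid1 Q (Suc i) (F_op 1 i F)
    = op_qbr Q (F_op 1 i) (F_op 1 (Suc i)) (braid1 Q (Suc i) F)"
proof
  fix a
  show "braid1 Q (Suc i) (F_op 1 i F) a
    = op_qbr Q (F_op 1 i) (F_op 1 (Suc i)) (braid1 Q (Suc i) F) a"
    by (simp add: op_defs shift_rules Q del: cancel_rules)
      (use Qinv(1) Qinv(2)[of "a (Suc i)"] Qinv(2)[of "a (Suc (Suc i))"] d
       in \<open>(intro disjI2)?; Groebner_Basis.algebra\<close>)
qed

lemma braid1_H: "braid1 Q i (H_op (Suc i) F)
    = (\<lambda>a. op_qbr (inverse Q) (E_op i) (op_qbr Q (H_op (Suc i)) (F_op 1 i)) (braid1 Q i F) a
      + H_op (Suc i) (diag_op Q (\<lambda>a. a (Suc i) - a i) (braid1 Q i F)) a)"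
proof
  fix a
  show "braid1 Q i (H_op (Suc i) F) a
    = op_qbr (inverse Q) (E_op i) (op_qbr Q (H_op (Suc i)) (F_op 1 i)) (braid1 Q i F) a
      + H_op (Suc i) (diag_op Q (\<lambda>a. a (Suc i) - a i) (braid1 Q i F)) a"
    by (simp add: op_defs shift_rules Q del: cancel_rules)
      (use Qinv(1) Qinv(2)[of "a i"] Qinv(2)[of "a (Suc i)"] d
       in \<open>(intro disjI2)?; Groebner_Basis.algebra\<close>)
qed

lemma braid2_E: "braid2 Q i (E_op i F)
    = (\<lambda>a. - diag_op Q (\<lambda>a. a i - a (Suc i)) (F_op 1 i (braid2 Q i F)) a)"
proof
  fix a
  show "braid2 Q i (E_op i F) a
    = - diag_op Q (\<lambda>a. a i - a (Suc i)) (F_op 1 i (braid2 Q i F)) a"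
    by (simp add: op_defs shift_rules Q del: cancel_rules)
      (use Qinv(1) Qinv(2)[of "a i"] Qinv(2)[of "a (Suc i)"] d
       in \<open>(intro disjI2)?; Groebner_Basis.algebra\<close>)
qed

lemma braid2_F: "braid2 Q i (F_op 1 i F)
    = (\<lambda>a. - E_op i (diag_op Q (\<lambda>a. a (Suc i) - a i) (braid2 Q i F)) a)"
proof
  fix a
  show "braid2 Q i (F_op 1 i F) a
    = - E_op i (diag_op Q (\<lambda>a. a (Suc i) - a i) (braid2 Q i F)) a"
    by (simp add: op_defs shift_rules Q del: cancel_rules)
      (use Qinv(1) Qinv(2)[of "a i"] Qinv(2)[of "a (Suc i)"] d
       in \<open>(intro disjI2)?; Groebner_Basis.algebra\<close>)
qed

lemma braid2_E_above: "braid2 Q i (E_op (Suc i) F)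
    = op_qbr (inverse Q) (E_op (Suc i)) (E_op i) (braid2 Q i F)"
proof
  fix a
  show "braid2 Q i (E_op (Suc i) F) a
    = op_qbr (inverse Q) (E_op (Suc i)) (E_op i) (braid2 Q i F) a"
    by (simp add: op_defs shift_rules Q del: cancel_rules)
      (use Qinv(1) Qinv(2)[of "a i"] Qinv(2)[of "a (Suc i)"] d
       in \<open>(intro disjI2)?; Groebner_Basis.algebra\<close>)
qed

lemma braid2_F_above: "braid2 Q i (F_op c (Suc i) F)
    = op_qbr Q (F_op 1 i) (F_op c (Suc i)) (braid2 Q i F)"
proof
  fix a
  show "braid2 Q i (F_op c (Suc i) F) a
    = op_qbr Q (F_op 1 i) (F_op c (Suc i)) (braid2 Q i F) a"
    by (simp add: op_defs shift_rules Q del: cancel_rules)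
      (use Qinv(1) Qinv(2)[of "a i"] Qinv(2)[of "a (Suc i)"] d
       in \<open>(intro disjI2)?; Groebner_Basis.algebra\<close>)
qed

lemma braid2_E_below: "braid2 Q (Suc i) (E_op i F)
    = op_qbr (inverse Q) (E_op i) (E_op (Suc i)) (braid2 Q (Suc i) F)"
proof
  fix a
  show "braid2 Q (Suc i) (E_op i F) a
    = op_qbr (inverse Q) (E_op i) (E_op (Suc i)) (braid2 Q (Suc i) F) a"
    by (simp add: op_defs shift_rules Q del: cancel_rules)
      (use Qinv(1) Qinv(2)[of "a (Suc i)"] Qinv(2)[of "a (Suc (Suc i))"] d
       in \<open>(intro disjI2)?; Groebner_Basis.algebra\<close>)
qed

lemma braid2_F_below: "braid2 Q (Suc i) (F_op 1 i F)
    = op_qbr Q (F_op 1 (Suc i)) (F_op 1 i) (braid2 Q (Suc i) F)"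
proof
  fix a
  show "braid2 Q (Suc i) (F_op 1 i F) a
    = op_qbr Q (F_op 1 (Suc i)) (F_op 1 i) (braid2 Q (Suc i) F) a"
    by (simp add: op_defs shift_rules Q del: cancel_rules)
      (use Qinv(1) Qinv(2)[of "a (Suc i)"] Qinv(2)[of "a (Suc (Suc i))"] d
       in \<open>(intro disjI2)?; Groebner_Basis.algebra\<close>)
qed

lemma braid2_H: "braid2 Q i (H_op (Suc i) F)
    = (\<lambda>a. op_qbr (inverse Q) (op_qbr Q (E_op i) (H_op (Suc i))) (F_op 1 i) (braid2 Q i F) a
      + H_op (Suc i) (diag_op Q (\<lambda>a. a (Suc i) - a i) (braid2 Q i F)) a)"
proof
  fix a
  show "braid2 Q i (H_op (Suc i) F) a
    = op_qbr (inverse Q) (op_qbr Q (E_op i) (H_op (Suc i))) (F_op 1 i) (braid2 Q i F) a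
      + H_op (Suc i) (diag_op Q (\<lambda>a. a (Suc i) - a i) (braid2 Q i F)) a"
    by (simp add: op_defs shift_rules Q del: cancel_rules)
      (use Qinv(1) Qinv(2)[of "a i"] Qinv(2)[of "a (Suc i)"] d
       in \<open>(intro disjI2)?; Groebner_Basis.algebra\<close>)
qed

text \<open>The diagonal operator for \<open>n = 2 r\<close>. The parameter \<open>2\<close> of \<^term>\<open>F_op\<close> and the weight
  \<open>a\<^sub>r - 2 a\<^bsub>r+1\<^esub> - 1\<close> of \<open>K\<^sub>r\<close> reflect \<open>c\<^bsub>r+1\<^esub> = 2\<close> and the factor \<open>q\<^sup>-\<^sup>1\<close> in \<open>\<phi>(K\<^sub>r)\<close>. A double bracket is
  needed at the index below, since moving a unit between \<open>X\<^bsub>r-1\<^esub>\<close> and \<open>X\<^sub>r\<close> changes the coefficient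
  of \<open>\<T>\<close> by a factor that involves both exponents of the tip.\<close>

lemma even_tip1_E: "even_tip1 Q i (E_op i F)
    = diag_op Q (\<lambda>a. a i - 2 * a (Suc i) - 1) (E_op i (even_tip1 Q i F))"
proof
  fix a
  show "even_tip1 Q i (E_op i F) a
    = diag_op Q (\<lambda>a. a i - 2 * a (Suc i) - 1) (E_op i (even_tip1 Q i F)) a"
    by (simp add: op_defs shift_rules Q del: cancel_rules)
      (use Qinv(1) Qinv(2)[of "a i"] Qinv(2)[of "a (Suc i)"] d
       in \<open>(intro disjI2)?; Groebner_Basis.algebra\<close>)
qed

lemma even_tip1_F: "even_tip1 Q i (F_op 2 i F)
    = F_op 2 i (diag_op Q (\<lambda>a. 2 * a (Suc i) + 1 - a i) (even_tip1 Q i F))"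
proof
  fix a
  show "even_tip1 Q i (F_op 2 i F) a
    = F_op 2 i (diag_op Q (\<lambda>a. 2 * a (Suc i) + 1 - a i) (even_tip1 Q i F)) a"
    by (simp add: op_defs shift_rules Q del: cancel_rules)
      (use Qinv(1) Qinv(2)[of "a i"] Qinv(2)[of "a (Suc i)"] d
       in \<open>(intro disjI2)?; Groebner_Basis.algebra\<close>)
qed

lemma even_tip1_E_below: "even_tip1 Q (Suc i) (E_op i F)
    = (\<lambda>a. inverse Q * op_qbr Q (op_qbr Q (E_op i) (E_op (Suc i))) (F_op 2 (Suc i)) (even_tip1 Q (Suc i) F) a
      - diag_op Q (\<lambda>a. a (Suc i) - 2 * a (Suc (Suc i)) - 1) (E_op i (even_tip1 Q (Suc i) F)) a)"
proof
  fix a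
  show "even_tip1 Q (Suc i) (E_op i F) a
    = inverse Q * op_qbr Q (op_qbr Q (E_op i) (E_op (Suc i))) (F_op 2 (Suc i)) (even_tip1 Q (Suc i) F) a
      - diag_op Q (\<lambda>a. a (Suc i) - 2 * a (Suc (Suc i)) - 1) (E_op i (even_tip1 Q (Suc i) F)) a"
    by (simp add: op_defs shift_rules Q del: cancel_rules)
      (use Qinv(1) Qinv(2)[of "a (Suc i)"] Qinv(2)[of "a (Suc (Suc i))"] d
       in \<open>(intro disjI2)?; Groebner_Basis.algebra\<close>)
qed

lemma even_tip1_F_below: "even_tip1 Q (Suc i) (F_op 1 i F)
    = (\<lambda>a. inverse Q * op_qbr Q (op_qbr Q (F_op 1 i) (F_op 2 (Suc i))) (E_op (Suc i)) (even_tip1 Q (Suc i) F) a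
      - F_op 1 i (diag_op Q (\<lambda>a. 2 * a (Suc (Suc i)) + 1 - a (Suc i)) (even_tip1 Q (Suc i) F)) a)"
proof
  fix a
  show "even_tip1 Q (Suc i) (F_op 1 i F) a
    = inverse Q * op_qbr Q (op_qbr Q (F_op 1 i) (F_op 2 (Suc i))) (E_op (Suc i)) (even_tip1 Q (Suc i) F) a
      - F_op 1 i (diag_op Q (\<lambda>a. 2 * a (Suc (Suc i)) + 1 - a (Suc i)) (even_tip1 Q (Suc i) F)) a"
    by (simp add: op_defs shift_rules Q del: cancel_rules)
      (use Qinv(1) Qinv(2)[of "a (Suc i)"] Qinv(2)[of "a (Suc (Suc i))"] d
       in \<open>(intro disjI2)?; Groebner_Basis.algebra\<close>)
qed

lemma even_tip2_E: "even_tip2 Q i (E_op i F)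
    = diag_op Q (\<lambda>a. 2 * a (Suc i) + 1 - a i) (E_op i (even_tip2 Q i F))"
proof
  fix a
  show "even_tip2 Q i (E_op i F) a
    = diag_op Q (\<lambda>a. 2 * a (Suc i) + 1 - a i) (E_op i (even_tip2 Q i F)) a"
    by (simp add: op_defs shift_rules Q del: cancel_rules)
      (use Qinv(1) Qinv(2)[of "a i"] Qinv(2)[of "a (Suc i)"] d
       in \<open>(intro disjI2)?; Groebner_Basis.algebra\<close>)
qed

lemma even_tip2_F: "even_tip2 Q i (F_op 2 i F)
    = F_op 2 i (diag_op Q (\<lambda>a. a i - 2 * a (Suc i) - 1) (even_tip2 Q i F))"
proof
  fix a
  show "even_tip2 Q i (F_op 2 i F) a
    = F_op 2 i (diag_op Q (\<lambda>a. a i - 2 * a (Suc i) - 1) (even_tip2 Q i F)) a"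
    by (simp add: op_defs shift_rules Q del: cancel_rules)
      (use Qinv(1) Qinv(2)[of "a i"] Qinv(2)[of "a (Suc i)"] d
       in \<open>(intro disjI2)?; Groebner_Basis.algebra\<close>)
qed

lemma even_tip2_E_below: "even_tip2 Q (Suc i) (E_op i F)
    = (\<lambda>a. inverse Q * op_qbr Q (F_op 2 (Suc i)) (op_qbr Q (E_op (Suc i)) (E_op i)) (even_tip2 Q (Suc i) F) a
      - diag_op Q (\<lambda>a. 2 * a (Suc (Suc i)) + 1 - a (Suc i)) (E_op i (even_tip2 Q (Suc i) F)) a)"
proof
  fix a
  show "even_tip2 Q (Suc i) (E_op i F) a
    = inverse Q * op_qbr Q (F_op 2 (Suc i)) (op_qbr Q (E_op (Suc i)) (E_op i)) (even_tip2 Q (Suc i) F) a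
      - diag_op Q (\<lambda>a. 2 * a (Suc (Suc i)) + 1 - a (Suc i)) (E_op i (even_tip2 Q (Suc i) F)) a"
    by (simp add: op_defs shift_rules Q del: cancel_rules)
      (use Qinv(1) Qinv(2)[of "a (Suc i)"] Qinv(2)[of "a (Suc (Suc i))"] d
       in \<open>(intro disjI2)?; Groebner_Basis.algebra\<close>)
qed

lemma even_tip2_F_below: "even_tip2 Q (Suc i) (F_op 1 i F)
    = (\<lambda>a. inverse Q * op_qbr Q (E_op (Suc i)) (op_qbr Q (F_op 2 (Suc i)) (F_op 1 i)) (even_tip2 Q (Suc i) F) a
      - F_op 1 i (diag_op Q (\<lambda>a. a (Suc i) - 2 * a (Suc (Suc i)) - 1) (even_tip2 Q (Suc i) F)) a)"
proof
  fix a
  show "even_tip2 Q (Suc i) (F_op 1 i F) a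
    = inverse Q * op_qbr Q (E_op (Suc i)) (op_qbr Q (F_op 2 (Suc i)) (F_op 1 i)) (even_tip2 Q (Suc i) F) a
      - F_op 1 i (diag_op Q (\<lambda>a. a (Suc i) - 2 * a (Suc (Suc i)) - 1) (even_tip2 Q (Suc i) F)) a"
    by (simp add: op_defs shift_rules Q del: cancel_rules)
      (use Qinv(1) Qinv(2)[of "a (Suc i)"] Qinv(2)[of "a (Suc (Suc i))"] d
       in \<open>(intro disjI2)?; Groebner_Basis.algebra\<close>)
qed

text \<open>The diagonal operator for \<open>n = 2 r + 1\<close>, whose coefficient involves one exponent only.\<close>

lemma odd_tip1_E: "odd_tip1 Q (Suc i) (E_op i F)
    = op_qbr (inverse Q) (H_op (Suc i)) (E_op i) (odd_tip1 Q (Suc i) F)"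
proof
  fix a
  show "odd_tip1 Q (Suc i) (E_op i F) a
    = op_qbr (inverse Q) (H_op (Suc i)) (E_op i) (odd_tip1 Q (Suc i) F) a"
    by (simp add: op_defs shift_rules Q del: cancel_rules)
      (use Qinv(1) Qinv(2)[of "a i"] Qinv(2)[of "a (Suc i)"] d
       in \<open>(intro disjI2)?; Groebner_Basis.algebra\<close>)
qed

lemma odd_tip1_F: "odd_tip1 Q (Suc i) (F_op 1 i F)
    = op_qbr Q (F_op 1 i) (H_op (Suc i)) (odd_tip1 Q (Suc i) F)"
proof
  fix a
  show "odd_tip1 Q (Suc i) (F_op 1 i F) a
    = op_qbr Q (F_op 1 i) (H_op (Suc i)) (odd_tip1 Q (Suc i) F) a"
    by (simp add: op_defs shift_rules Q del: cancel_rules)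
      (use Qinv(1) Qinv(2)[of "a i"] Qinv(2)[of "a (Suc i)"] d
       in \<open>(intro disjI2)?; Groebner_Basis.algebra\<close>)
qed

lemma odd_tip2_E: "odd_tip2 Q (Suc i) (E_op i F)
    = op_qbr Q (H_op (Suc i)) (E_op i) (odd_tip2 Q (Suc i) F)"
proof
  fix a
  show "odd_tip2 Q (Suc i) (E_op i F) a
    = op_qbr Q (H_op (Suc i)) (E_op i) (odd_tip2 Q (Suc i) F) a"
    by (simp add: op_defs shift_rules Q del: cancel_rules)
      (use Qinv(1) Qinv(2)[of "a i"] Qinv(2)[of "a (Suc i)"] d
       in \<open>(intro disjI2)?; Groebner_Basis.algebra\<close>)
qed

lemma odd_tip2_F: "odd_tip2 Q (Suc i) (F_op 1 i F)
    = op_qbr (inverse Q) (F_op 1 i) (H_op (Suc i)) (odd_tip2 Q (Suc i) F)"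
proof
  fix a
  show "odd_tip2 Q (Suc i) (F_op 1 i F) a
    = op_qbr (inverse Q) (F_op 1 i) (H_op (Suc i)) (odd_tip2 Q (Suc i) F) a"
    by (simp add: op_defs shift_rules Q del: cancel_rules)
      (use Qinv(1) Qinv(2)[of "a i"] Qinv(2)[of "a (Suc i)"] d
       in \<open>(intro disjI2)?; Groebner_Basis.algebra\<close>)
qed

end

section \<open>The generators of the \<open>\<imath>\<close>quantum group as operators\<close>

text \<open>Quantum integers are invariant under \<open>q \<mapsto> q\<^sup>-\<^sup>1\<close>, so both signs of \<open>e\<close> are covered by \<open>Q = q\<^sup>e\<close>.\<close>
lemma q_param_power:
  assumes "e \<in> {1, - 1 :: int}"
  shows "q_param (q powi e) (inverse (q powi e - inverse (q powi e)))"
proof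
  show "q powi e \<noteq> 0" by simp
  have nz: "q powi e - inverse (q powi e) \<noteq> 0"
    using assms q_minus_inverse by (auto simp del: q_minus_inverse)
  then show "inverse (q powi e - inverse (q powi e)) * (q powi e - inverse (q powi e)) = 1"
    by simp
  show "qint k = inverse (q powi e - inverse (q powi e)) * ((q powi e) powi k - inverse ((q powi e) powi k))" for k
  proof (cases "e = 1")
    case True
    then show ?thesis by (simp add: qint_def power_int_minus divide_inverse mult.commute)
  next
    case False
    then have e: "e = -1" using assms by simp
    have "inverse (inverse q - q) = - inverse (q - inverse q)"
      by (metis inverse_minus_eq minus_diff_eq)
    then show ?thesis by (simp add: e qint_def power_int_minus power_int_inverse divide_inverse algebra_simps)
  qed
qed

text \<open>The exponent of \<open>q\<close> in the scalar by which \<open>\<phi>(K\<^sub>p)\<close> multiplies the monomial \<open>X\<^sup>a\<close>, for \<open>1 \<le> p \<le> r\<close>.\<close>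
definition weight_K :: "nat \<Rightarrow> nat \<Rightarrow> nat \<Rightarrow> (nat \<Rightarrow> int) \<Rightarrow> int" where
  "weight_K r n p a = a p - int (cc r n (Suc p)) * a (Suc p) - of_bool (n = 2 * r \<and> p = r)"

fun iU_op :: "nat \<Rightarrow> nat \<Rightarrow> igen \<Rightarrow> laurent \<Rightarrow> laurent" where
  "iU_op r n (GB j) =
     (if j \<le> r then E_op j
      else if n = 2 * r + 1 \<and> j = r + 1 then H_op j
      else F_op (int (cc r n (Suc (rho n j)))) (rho n j))"
| "iU_op r n (GK j) =
     diag_op q (if j \<le> r then weight_K r n j else (\<lambda>a. - weight_K r n (rho n j) a))"

lemma linear_op_iU_op: "linear_op (iU_op r n g)"
  by (cases g) (auto simp: linear_op_def fun_eq_iff E_op_def F_op_def H_op_def diag_op_def algebra_simps)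

lemmas weyl_word_rules = word_act_mult[of "weyl_op r n", OF linear_op_weyl_op] word_act_scal word_act_gen for r n

lemmas iU_word_rules = word_act_diff word_act_add word_act_uminus word_act_mult[of "iU_op r n", OF linear_op_iU_op]
  word_act_one word_act_scal word_act_gen for r n

lemma word_act_qbr: "word_act (iU_op r n) (qbr k x y) F a
    = op_qbr (q powi k) (word_act (iU_op r n) x) (word_act (iU_op r n) y) F a"
  by (simp add: qbr_def op_qbr_def iU_word_rules)

locale rank_parity =
  fixes r n :: nat
  assumes n: "n = 2 * r \<or> n = 2 * r + 1"
begin

lemma iU_op_low: "p \<le> r \<Longrightarrow> iU_op r n (GB p) = E_op p"
  by simp

lemma iU_op_high: "1 \<le> p \<Longrightarrow> p \<le> r \<Longrightarrow> iU_op r n (GB (rho n p)) = F_op (int (cc r n (Suc p))) p"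
  using n by (auto simp: rho_def)

lemma iU_op_mid: "n = 2 * r + 1 \<Longrightarrow> iU_op r n (GB (Suc r)) = H_op (Suc r)"
  by simp

text \<open>The generators come in mirror pairs \<open>p\<close>, \<open>\<rho>\<^sub>n(p)\<close> with \<open>p \<le> r\<close>, and one generator is fixed by \<open>\<rho>\<^sub>n\<close> if \<open>n\<close> is odd.\<close>
lemma index_cases:
  assumes "j \<in> {1..n}"
  obtains (low) "1 \<le> j" "j \<le> r" | (high) p where "1 \<le> p" "p \<le> r" "j = rho n p"
    | (mid) "n = 2 * r + 1" "j = Suc r"
proof -
  consider "j \<le> r" | "j > r" "\<not> (n = 2 * r + 1 \<and> j = Suc r)" | "n = 2 * r + 1 \<and> j = Suc r" by linarith
  then show ?thesis
  proof cases
    case 2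
    then have "1 \<le> rho n j" "rho n j \<le> r" "j = rho n (rho n j)"
      using n assms by (auto simp: rho_def)
    then show ?thesis using high by blast
  qed (use assms low mid in auto)
qed

lemma rho_rho: "1 \<le> p \<Longrightarrow> p \<le> r \<Longrightarrow> rho n (rho n p) = p"
  using n by (auto simp: rho_def)

lemma rho_gt: "1 \<le> p \<Longrightarrow> p \<le> r \<Longrightarrow> r < rho n p"
  using n by (auto simp: rho_def)

lemma iU_op_Kpow:
  assumes "e \<in> {1, - 1}" "1 \<le> p" "p \<le> r"
  shows "word_act (iU_op r n) (Kpow n e p) = diag_op (q powi e) (weight_K r n p)"
    and "word_act (iU_op r n) (Kpow n e (rho n p)) = diag_op (q powi e) (\<lambda>a. - weight_K r n p a)"
  using assms rho_gt[of p] rho_rho[of p]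
  by (auto simp: Kpow_def word_act_gen fun_eq_iff diag_op_def power_int_minus power_int_inverse)

lemma weyl_op_E: "cc r n p = 1 \<Longrightarrow> weyl_op r n (GX (Suc p)) (weyl_op r n (GD p) F) = E_op p F"
  by (simp add: fun_eq_iff E_op_def fun_upd_sort)

lemma weyl_op_F: "weyl_op r n (GX p) (weyl_op r n (GD (Suc p)) F) = F_op (int (cc r n (Suc p))) p F"
  by (simp add: fun_eq_iff F_op_def)

lemma weyl_op_H: "cc r n p = 1 \<Longrightarrow> weyl_op r n (GX p) (weyl_op r n (GD p) F) = H_op p F"
  by (simp add: fun_eq_iff H_op_def)

lemma cc_low: "p \<le> r \<Longrightarrow> cc r n p = 1"
  by (simp add: cc_def)

lemma weyl_op_phi_K:
  assumes "p \<le> r"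
  shows "word_act (weyl_op r n) (phi_K r n p) F = diag_op q (weight_K r n p) F"
proof -
  show ?thesis
    using cc_low[OF assms]
    by (auto simp: phi_K_def weyl_word_rules fun_eq_iff diag_op_def weight_K_def power_int_diff power_int_minus
        divide_inverse)
qed

lemma iU_rels_in_free_alg: "snd (iU r n) \<subseteq> carrier (free_alg (fst (iU r n)))"
  using iU_rels_closed by (simp add: iU_def del: free_alg_simps)

lemma iU_gen_in_free_alg: "h \<in> fst (iU r n) \<Longrightarrow> gen h \<in> carrier (free_alg (fst (iU r n)))"
  by (simp only: free_alg_gen_closed)

text \<open>The relation \<open>K\<^sub>j K\<^bsub>\<rho>(j)\<^esub> = 1\<close> survives under every homomorphism. It determines the
  operators of the mirror generators \<open>K\<^bsub>\<rho>(p)\<^esub>\<close>, which \<open>\<phi>\<close> and \<open>\<tau>\<close> fix only through inverses.\<close>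
lemma hom_K_inverse:
  assumes \<psi>: "\<psi> \<in> alg_hom (iU r n) (Aq r n)" and j: "j \<in> {1..n}" "rho n j \<noteq> j"
  shows "cls_act (weyl_op r n) (\<psi> (cls (iU r n) (K j))) (cls_act (weyl_op r n) (\<psi> (cls (iU r n) (K (rho n j)))) F) = F"
proof -
  let ?U = "iU r n"
  interpret letter_rep "Aq r n" "weyl_op r n" by (rule letter_rep_weyl_op)
  interpret I: ideal "rel_ideal ?U" "free_alg (fst ?U)"
    by (rule ideal_rel_ideal[OF iU_rels_in_free_alg])
  have hom: "cls ?U \<in> ring_hom (free_alg (fst ?U)) (presented ?U)"
    by (rule cls_ring_hom[OF iU_rels_in_free_alg])
  have \<psi>': "\<psi> \<in> ring_hom (presented ?U) (presented (Aq r n))" using \<psi> by (simp add: alg_hom_def)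
  have KK: "K j \<in> carrier (free_alg (fst ?U))" "K (rho n j) \<in> carrier (free_alg (fst ?U))"
    by (rule iU_gen_in_free_alg; use j in \<open>auto simp: iU_def iU_gens_def rho_def\<close>)+
  have "K j * K (rho n j) - 1 \<in> snd ?U"
    using j by (auto simp: iU_def iU_rels_def)
  then have "K j * K (rho n j) - 1 \<in> rel_ideal ?U"
    unfolding rel_ideal_def using ring.genideal_self[OF ring_free_alg iU_rels_in_free_alg] by blast
  then have "K j * K (rho n j) \<in> cls ?U (scal 1)"
    by (force simp: cls_def a_r_coset_def' scal_one)
  then have eq: "cls ?U (K j * K (rho n j)) = cls ?U (scal 1)"
    unfolding cls_def using I.a_repr_independence[OF _ free_alg_scal_closed I.a_subgroup] by metis
  have "\<psi> (cls ?U (K j * K (rho n j))) = cls (Aq r n) (scal 1)"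
    unfolding eq using \<psi> by (simp add: alg_hom_def)
  moreover have "\<psi> (cls ?U (K j * K (rho n j)))
      = \<psi> (cls ?U (K j)) \<otimes>\<^bsub>presented (Aq r n)\<^esub> \<psi> (cls ?U (K (rho n j)))"
    using ring_hom_mult[OF hom KK] ring_hom_mult[OF \<psi>' ring_hom_closed[OF hom KK(1)] ring_hom_closed[OF hom KK(2)]]
    by simp
  ultimately have "cls_act (weyl_op r n) (\<psi> (cls ?U (K j)) \<otimes>\<^bsub>presented (Aq r n)\<^esub> \<psi> (cls ?U (K (rho n j)))) F = F"
    using cls_act_scal[of 1 F] by simp
  then show ?thesis
    using cls_act_mult[OF ring_hom_closed[OF \<psi>' ring_hom_closed[OF hom KK(1)]]
        ring_hom_closed[OF \<psi>' ring_hom_closed[OF hom KK(2)]]] by simp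
qed

lemma Aq_gens_closed:
  assumes "1 \<le> p" "p \<le> Suc r"
  shows "Xw p \<in> carrier (free_alg (fst (Aq r n)))" "Dw p \<in> carrier (free_alg (fst (Aq r n)))"
    "Mw p \<in> carrier (free_alg (fst (Aq r n)))" "Minvw p \<in> carrier (free_alg (fst (Aq r n)))"
  using assms by (simp_all only: free_alg_gen_closed Aq_def fst_conv) (auto simp: Aq_gens_def)

text \<open>The module structure through \<open>\<phi>\<close> is given by the operators \<^const>\<open>iU_op\<close>. At a mirror generator \<open>K\<^bsub>\<rho>(p)\<^esub>\<close>
  the operator is found by inverting the diagonal operator of \<open>K\<^sub>p\<close>.\<close>
lemma phi_acts:
  assumes \<phi>: "is_phi r n \<phi>" and h: "h \<in> fst (iU r n)"
  shows "cls_act (weyl_op r n) (\<phi> (cls (iU r n) (gen h))) F = iU_op r n h F"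
proof -
  interpret letter_rep "Aq r n" "weyl_op r n" by (rule letter_rep_weyl_op)
  note c = free_alg_mult_closed[OF Aq_gens_closed(1) Aq_gens_closed(2)]
  have low: "cls_act (weyl_op r n) (\<phi> (cls (iU r n) (B p))) F = iU_op r n (GB p) F"
    "cls_act (weyl_op r n) (\<phi> (cls (iU r n) (B (rho n p)))) F = iU_op r n (GB (rho n p)) F"
    "cls_act (weyl_op r n) (\<phi> (cls (iU r n) (K p))) F = iU_op r n (GK p) F" if p: "1 \<le> p" "p \<le> r" for p F
  proof -
    have "phi_K r n p \<in> carrier (free_alg (fst (Aq r n)))"
      using p unfolding phi_K_def
      by (intro free_alg_closed Aq_gens_closed) auto
    moreover have "\<phi> (cls (iU r n) (B p)) = cls (Aq r n) (Xw (p + 1) * Dw p)"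
      "\<phi> (cls (iU r n) (B (rho n p))) = cls (Aq r n) (Xw p * Dw (p + 1))"
      "\<phi> (cls (iU r n) (K p)) = cls (Aq r n) (phi_K r n p)"
      using \<phi> p by (auto simp: is_phi_def)
    ultimately show "cls_act (weyl_op r n) (\<phi> (cls (iU r n) (B p))) F = iU_op r n (GB p) F"
      "cls_act (weyl_op r n) (\<phi> (cls (iU r n) (B (rho n p)))) F = iU_op r n (GB (rho n p)) F"
      "cls_act (weyl_op r n) (\<phi> (cls (iU r n) (K p))) F = iU_op r n (GK p) F"
      using p iU_op_high[OF p] c[of "p + 1" p] c[of p "p + 1"]
      by (simp_all add: cls_act_cls weyl_word_rules weyl_op_E[OF cc_low] weyl_op_F weyl_op_phi_K
          del: free_alg_simps weyl_op.simps iU_op.simps(1))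
        (simp_all add: iU_op_low)
  qed
  show ?thesis
  proof (cases h)
    case (GB j)
    then have "j \<in> {1..n}" using h by (auto simp: iU_def iU_gens_def)
    then show ?thesis unfolding GB
    proof (cases rule: index_cases)
      case mid
      then have "\<phi> (cls (iU r n) (B j)) = cls (Aq r n) (Xw (r + 1) * Dw (r + 1))"
        using \<phi> by (auto simp: is_phi_def)
      moreover have "cc r n (Suc r) = 1" using mid by (simp add: cc_def)
      ultimately show "cls_act (weyl_op r n) (\<phi> (cls (iU r n) (B j))) F = iU_op r n (GB j) F"
        using c[of "r + 1" "r + 1"] iU_op_mid[OF mid(1)] mid(2)
        by (simp add: cls_act_cls weyl_word_rules weyl_op_H del: free_alg_simps weyl_op.simps iU_op.simps(1))
    qed (simp_all only: low)
  next
    case (GK j)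
    then have j: "j \<in> {1..n}" "rho n j \<noteq> j" using h by (auto simp: iU_def iU_gens_def)
    from j(1) show ?thesis unfolding GK
    proof (cases rule: index_cases)
      case (high p)
      have pn: "p \<in> {1..n}" "rho n p \<noteq> p" using high n by (auto simp: rho_def)
      let ?G = "cls_act (weyl_op r n) (\<phi> (cls (iU r n) (K (rho n p)))) F"
      have "iU_op r n (GK p) ?G = F"
        using hom_K_inverse[of \<phi> p F] \<phi> pn low(3)[OF high(1,2)] by (simp add: is_phi_def)
      then have G: "q powi weight_K r n p a * ?G a = F a" for a
        using high(2) by (simp add: diag_op_def fun_eq_iff)
      have "?G = iU_op r n (GK (rho n p)) F"
        using rho_gt[OF high(1,2)] rho_rho[OF high(1,2)]
        by (auto simp: fun_eq_iff diag_op_def G[symmetric] power_int_minus)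
      then show "cls_act (weyl_op r n) (\<phi> (cls (iU r n) (K j))) F = iU_op r n (GK j) F"
        by (simp only: high(3))
    next
      case mid
      then have False using j(2) by (simp add: rho_def)
      then show "cls_act (weyl_op r n) (\<phi> (cls (iU r n) (K j))) F = iU_op r n (GK j) F" ..
    qed (simp_all only: low)
  qed
qed

text \<open>It is enough to test an intertwiner on all \<open>B\<^sub>j\<close> and on the \<open>K\<^sub>j\<close> with \<open>j \<le> r\<close>. For the remaining \<open>K\<close> one
  multiplies the identity for \<open>K\<^sub>p\<close> by the inverse operators on both sides.\<close>
lemma intertwine_from_gens:
  assumes \<phi>: "is_phi r n \<phi>" and \<tau>: "\<tau> \<in> alg_hom (iU r n) (iU r n)"
    and T: "linear_op T"
    and B_val: "\<And>j. j \<in> {1..n} \<Longrightarrow> \<tau> (cls (iU r n) (B j)) = cls (iU r n) (b j)"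
    and K_val: "\<And>j. j \<in> {1..r} \<Longrightarrow> \<tau> (cls (iU r n) (K j)) = cls (iU r n) (k j)"
    and b: "\<And>j. j \<in> {1..n} \<Longrightarrow> b j \<in> carrier (free_alg (fst (iU r n)))"
    and k: "\<And>j. j \<in> {1..r} \<Longrightarrow> k j \<in> carrier (free_alg (fst (iU r n)))"
    and TB: "\<And>j F. j \<in> {1..n} \<Longrightarrow> T (iU_op r n (GB j) F) = word_act (iU_op r n) (b j) (T F)"
    and TK: "\<And>j F. j \<in> {1..r} \<Longrightarrow> T (iU_op r n (GK j) F) = word_act (iU_op r n) (k j) (T F)"
    and U: "U \<in> carrier (presented (iU r n))"
  shows "T (cls_act (weyl_op r n) (\<phi> U) F) = cls_act (weyl_op r n) (\<phi> (\<tau> U)) (T F)"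
proof -
  interpret letter_rep "Aq r n" "weyl_op r n" by (rule letter_rep_weyl_op)
  have \<phi>h: "\<phi> \<in> alg_hom (iU r n) (Aq r n)" using \<phi> by (simp add: is_phi_def)
  have \<phi>\<tau>: "(\<lambda>U. \<phi> (\<tau> U)) \<in> alg_hom (iU r n) (Aq r n)"
    by (rule alg_hom_comp[OF \<tau> \<phi>h])
  have act: "cls_act (weyl_op r n) (\<phi> (cls (iU r n) x)) F = word_act (iU_op r n) x F"
    if "x \<in> carrier (free_alg (fst (iU r n)))" for x F
    by (rule intertwine_extend[OF iU_rels_in_free_alg \<phi>h
        linear_op_iU_op linear_op_id phi_acts[OF \<phi>, symmetric] that, symmetric])
  have K_low: "T (iU_op r n (GK p) F) = cls_act (weyl_op r n) (\<phi> (\<tau> (cls (iU r n) (K p)))) (T F)"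
    if "1 \<le> p" "p \<le> r" for p F
    using that TK K_val act[OF k] by simp
  have gens: "T (iU_op r n h F) = cls_act (weyl_op r n) (\<phi> (\<tau> (cls (iU r n) (gen h)))) (T F)"
    if h: "h \<in> fst (iU r n)" for h F
  proof (cases h)
    case (GB j)
    then have "j \<in> {1..n}" using h by (auto simp: iU_def iU_gens_def)
    then show ?thesis using GB TB B_val act[OF b] by simp
  next
    case (GK j)
    then have j: "j \<in> {1..n}" "rho n j \<noteq> j" using h by (auto simp: iU_def iU_gens_def)
    from j(1) show ?thesis unfolding GK
    proof (cases rule: index_cases)
      case low
      then show "T (iU_op r n (GK j) F) = cls_act (weyl_op r n) (\<phi> (\<tau> (cls (iU r n) (K j)))) (T F)"
        by (rule K_low)
    next
      case (high p)
      let ?G = "iU_op r n (GK (rho n p)) F"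
      have "iU_op r n (GK p) ?G = F"
        using high rho_gt[of p] rho_rho[of p] by (auto simp: fun_eq_iff diag_op_def power_int_minus)
      then have "T F = cls_act (weyl_op r n) (\<phi> (\<tau> (cls (iU r n) (K p)))) (T ?G)"
        using K_low[OF high(1,2), of ?G] by simp
      moreover have "rho n p \<in> {1..n}" "rho n (rho n p) \<noteq> rho n p" using high n by (auto simp: rho_def)
      ultimately have "cls_act (weyl_op r n) (\<phi> (\<tau> (cls (iU r n) (K (rho n p))))) (T F) = T ?G"
        using hom_K_inverse[OF \<phi>\<tau>, of "rho n p" "T ?G"] rho_rho[OF high(1,2)] by simp
      then show "T (iU_op r n (GK j) F) = cls_act (weyl_op r n) (\<phi> (\<tau> (cls (iU r n) (K j)))) (T F)"
        by (simp only: high(3))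
    next
      case mid
      then have False using j(2) by (simp add: rho_def)
      then show "T (iU_op r n (GK j) F) = cls_act (weyl_op r n) (\<phi> (\<tau> (cls (iU r n) (K j)))) (T F)" ..
    qed
  qed
  obtain x where x: "x \<in> carrier (free_alg (fst (iU r n)))" "U = cls (iU r n) x"
    using U by (auto simp: presented_carrier simp del: free_alg_simps)
  show ?thesis
    unfolding x(2) act[OF x(1)]
    by (rule intertwine_extend[OF iU_rels_in_free_alg \<phi>\<tau> linear_op_iU_op T gens x(1)])
qed

end

section \<open>Intertwining\<close>

text \<open>The sign \<open>e\<close> can be taken out of the halved exponent, because the division by two is exact.\<close>
lemma half_even_exponent:
  fixes e x :: int
  shows "(e * x\<^sup>2 + 3 * e * x) div 2 = e * ((x * x + 3 * x) div 2)"
    "(- (e * x\<^sup>2) - 3 * e * x) div 2 = - (e * ((x * x + 3 * x) div 2))"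
proof -
  have "even (x * x + 3 * x)" by simp
  then obtain m where m: "x * x + 3 * x = 2 * m" by blast
  have "e * x\<^sup>2 + 3 * e * x = e * (x * x + 3 * x)" "- (e * x\<^sup>2) - 3 * e * x = - (e * (x * x + 3 * x))"
    by (simp_all add: power2_eq_square algebra_simps)
  then have "e * x\<^sup>2 + 3 * e * x = 2 * (e * m)" "- (e * x\<^sup>2) - 3 * e * x = 2 * (- (e * m))"
    by (simp_all only: m)
  then show "(e * x\<^sup>2 + 3 * e * x) div 2 = e * ((x * x + 3 * x) div 2)"
    "(- (e * x\<^sup>2) - 3 * e * x) div 2 = - (e * ((x * x + 3 * x) div 2))"
    using m by simp_all
qed

lemma half_odd_exponent:
  fixes e y :: int
  shows "(e * y\<^sup>2 - e * y) div 2 = e * ((y * y - y) div 2)"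
    "(- (e * y\<^sup>2) + e * y) div 2 = - (e * ((y * y - y) div 2))"
proof -
  have "even (y * y - y)" by simp
  then obtain m where m: "y * y - y = 2 * m" by blast
  then have "e * y\<^sup>2 - e * y = 2 * (e * m)" "- (e * y\<^sup>2) + e * y = 2 * (- (e * m))"
    using arg_cong[OF m, of "\<lambda>z. e * z"] by (simp_all add: power2_eq_square algebra_simps)
  then show "(e * y\<^sup>2 - e * y) div 2 = e * ((y * y - y) div 2)"
    "(- (e * y\<^sup>2) + e * y) div 2 = - (e * ((y * y - y) div 2))"
    using m by simp_all
qed

lemma T1_op_braid: "i < Nr n \<Longrightarrow> T1_op r n e i = braid1 (q powi e) i"
  by (simp add: T1_op_def braid1_def braid1_coeff_def fun_eq_iff power_int_minus
      power_int_mult[symmetric] mult_ac)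

lemma T2_op_braid: "i < Nr n \<Longrightarrow> T2_op r n e i = braid2 (q powi e) i"
  by (simp add: T2_op_def braid2_def braid2_coeff_def fun_eq_iff power_int_minus
      power_int_mult[symmetric] mult_ac)

lemma T_op_even_tip:
  assumes "n = 2 * r"
  shows "T1_op r n e r = even_tip1 (q powi e) r" "T2_op r n e r = even_tip2 (q powi e) r"
proof -
  have exponents: "e * ((x * x + 3 * x) div 2) - e * y + 2 * e * x * y = e * even_exponent x y"
    "- (e * ((x * x + 3 * x) div 2)) + e * y - 2 * e * x * y = e * (- even_exponent x y)" for x y
    by (simp_all add: even_exponent_def algebra_simps)
  show "T1_op r n e r = even_tip1 (q powi e) r" "T2_op r n e r = even_tip2 (q powi e) r"
    using assms by (simp_all add: fun_eq_iff T1_op_def T2_op_def even_tip1_def even_tip2_def Nr_def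
        half_even_exponent exponents[simplified] power_int_mult[symmetric])
qed

lemma T_op_odd_tip:
  assumes "n = 2 * r + 1"
  shows "T1_op r n e (Suc r) = odd_tip1 (q powi e) (Suc r)" "T2_op r n e (Suc r) = odd_tip2 (q powi e) (Suc r)"
  using assms by (simp_all add: fun_eq_iff T1_op_def T2_op_def odd_tip1_def odd_tip2_def Nr_def odd_exponent_def
        half_odd_exponent half_odd_exponent(2)[simplified] power_int_mult[symmetric])

text \<open>Generators at a distance from \<open>i\<close> are fixed by \<open>\<tau>\<close> and involve neither variable that \<open>\<T>\<close> exchanges.\<close>
lemma braid_commutes_far:
  assumes "p \<noteq> i" "Suc p \<noteq> i" "p \<noteq> Suc i"
  shows "braid1 Q i (E_op p F) = E_op p (braid1 Q i F)" "braid2 Q i (E_op p F) = E_op p (braid2 Q i F)"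
    "braid1 Q i (F_op c p F) = F_op c p (braid1 Q i F)" "braid2 Q i (F_op c p F) = F_op c p (braid2 Q i F)"
proof -
  have 1: "(swap_vec i a)(p := a p + 1, Suc p := a (Suc p) - 1)
      = swap_vec i (a(p := a p + 1, Suc p := a (Suc p) - 1))"
    "(swap_vec i a)(p := a p - 1, Suc p := a (Suc p) + 1)
        = swap_vec i (a(p := a p - 1, Suc p := a (Suc p) + 1))"
    and 2: "swap_vec i a p = a p" "swap_vec i a (Suc p) = a (Suc p)" for a
    using assms by (auto simp: swap_vec_def fun_eq_iff)
  show "braid1 Q i (E_op p F) = E_op p (braid1 Q i F)" "braid2 Q i (E_op p F) = E_op p (braid2 Q i F)"
    "braid1 Q i (F_op c p F) = F_op c p (braid1 Q i F)" "braid2 Q i (F_op c p F) = F_op c p (braid2 Q i F)"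
    using assms
    by (simp_all add: fun_eq_iff braid1_def braid2_def E_op_def F_op_def 1 2 mult.left_commute)
qed

lemma braid_commutes_H:
  assumes "p \<noteq> i" "p \<noteq> Suc i"
  shows "braid1 Q i (H_op p F) = H_op p (braid1 Q i F)" "braid2 Q i (H_op p F) = H_op p (braid2 Q i F)"
  using assms by (simp_all add: fun_eq_iff braid1_def braid2_def H_op_def swap_vec_def mult.left_commute)

lemma even_tip_commutes_far:
  assumes "p < i" "Suc p \<noteq> i"
  shows "even_tip1 Q i (E_op p F) = E_op p (even_tip1 Q i F)"
      "even_tip2 Q i (E_op p F) = E_op p (even_tip2 Q i F)"
    "even_tip1 Q i (F_op c p F) = F_op c p (even_tip1 Q i F)"
        "even_tip2 Q i (F_op c p F) = F_op c p (even_tip2 Q i F)"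
  using assms by (simp_all add: fun_eq_iff even_tip1_def even_tip2_def E_op_def F_op_def mult.left_commute)

lemma odd_tip_commutes_far:
  assumes "Suc p < i"
  shows "odd_tip1 Q i (E_op p F) = E_op p (odd_tip1 Q i F)" "odd_tip2 Q i (E_op p F) = E_op p (odd_tip2 Q i F)"
    "odd_tip1 Q i (F_op c p F) = F_op c p (odd_tip1 Q i F)"
        "odd_tip2 Q i (F_op c p F) = F_op c p (odd_tip2 Q i F)"
  using assms by (simp_all add: fun_eq_iff odd_tip1_def odd_tip2_def E_op_def F_op_def mult.left_commute)

lemma odd_tip_commutes_H: "odd_tip1 Q i (H_op p F) = H_op p (odd_tip1 Q i F)"
    "odd_tip2 Q i (H_op p F) = H_op p (odd_tip2 Q i F)"
  by (simp_all add: fun_eq_iff odd_tip1_def odd_tip2_def H_op_def mult.left_commute)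

locale braid_setting = rank_parity +
  fixes e :: int
  assumes e: "e \<in> {1, - 1}"
begin

text \<open>The values of \<open>\<tau>\<close> sorted by mirror pairs. For \<open>i < N\<close> the indices \<open>i\<close> and \<open>\<rho>\<^sub>n(i)\<close> are at least two apart,
  so a neighbour in the lower half is bracketed only with \<open>B\<^sub>i\<close> and one in the upper half only with
  \<open>B\<^bsub>\<rho>(i)\<^esub>\<close>; the middle generator of odd \<open>n\<close> is the exception.\<close>
lemma tau_B_braid:
  assumes i: "1 \<le> i" "i < Nr n" and p: "1 \<le> p" "p \<le> r"
  shows "tau1_B r n e i p = (if p = i then - (B (rho n i) * Kpow n e (rho n i))
      else if p = Suc i \<or> i = Suc p then qbr (- e) (B i) (B p) else B p)"
    "tau1_B r n e i (rho n p) = (if p = i then - (Kpow n e i * B i)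
      else if p = Suc i \<or> i = Suc p then qbr e (B (rho n p)) (B (rho n i)) else B (rho n p))"
    "tau2_B r n e i p = (if p = i then - (Kpow n e i * B (rho n i))
      else if p = Suc i \<or> i = Suc p then qbr (- e) (B p) (B i) else B p)"
    "tau2_B r n e i (rho n p) = (if p = i then - (B i * Kpow n e (rho n i))
      else if p = Suc i \<or> i = Suc p then qbr e (B (rho n i)) (B (rho n p)) else B (rho n p))"
proof -
  have ir: "i \<le> r" "\<not> (n = 2 * r \<and> i = r)" "i \<noteq> r + 1" using i n by (auto simp: Nr_def)
  have rho: "rho n i \<noteq> i" "\<not> (n = 2 * r + 1 \<and> i = r \<and> rho n i = r + 1)"
    "rho n i \<noteq> p" "p \<noteq> rho n i"
    "rho n p \<noteq> i" "rho n p = rho n i \<longleftrightarrow> p = i" "p \<noteq> r + 1" "\<not> (n = 2 * r + 1 \<and> i = r \<and> rho n p = r + 1)"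
    using i ir p n by (auto simp: rho_def)
  have cdot: "cdot (rho n i) p \<noteq> - 1" "cdot i (rho n p) \<noteq> - 1"
    "p \<noteq> i \<Longrightarrow> cdot (rho n i) (rho n p) = - 1 \<longleftrightarrow> p = Suc i \<or> i = Suc p"
    "p \<noteq> i \<Longrightarrow> cdot i p = - 1 \<longleftrightarrow> p = Suc i \<or> i = Suc p"
    using i ir p n by (auto simp: rho_def cdot_def)
  note facts = ir rho cdot
  show "tau1_B r n e i p = (if p = i then - (B (rho n i) * Kpow n e (rho n i))
      else if p = Suc i \<or> i = Suc p then qbr (- e) (B i) (B p) else B p)"
    by (cases "p = i"; simp only: tau1_B_def facts if_True if_False simp_thms)
  show "tau2_B r n e i p = (if p = i then - (Kpow n e i * B (rho n i))
      else if p = Suc i \<or> i = Suc p then qbr (- e) (B p) (B i) else B p)"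
    by (cases "p = i"; simp only: tau2_B_def facts if_True if_False simp_thms)
  show "tau1_B r n e i (rho n p) = (if p = i then - (Kpow n e i * B i)
      else if p = Suc i \<or> i = Suc p then qbr e (B (rho n p)) (B (rho n i)) else B (rho n p))"
    by (cases "p = i"; simp only: tau1_B_def facts if_True if_False simp_thms)
  show "tau2_B r n e i (rho n p) = (if p = i then - (B i * Kpow n e (rho n i))
      else if p = Suc i \<or> i = Suc p then qbr e (B (rho n i)) (B (rho n p)) else B (rho n p))"
    by (cases "p = i"; simp only: tau2_B_def facts if_True if_False simp_thms)
qed

lemma tau_B_braid_mid:
  assumes "n = 2 * r + 1" and i: "1 \<le> i" "i < Nr n"
  shows "tau1_B r n e i (Suc r) = (if i = r
      then qbr (- e) (B r) (qbr e (B (Suc r)) (B (rho n r))) + B (Suc r) * Kpow n e (rho n r) else B (Suc r))"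
    "tau2_B r n e i (Suc r) = (if i = r
      then qbr (- e) (qbr e (B r) (B (Suc r))) (B (rho n r)) + B (Suc r) * Kpow n e (rho n r) else B (Suc r))"
  using assms by (auto simp: tau1_B_def tau2_B_def rho_def cdot_def Nr_def)

lemma tau_B_even_tip:
  assumes "n = 2 * r" and p: "1 \<le> p" "p \<le> r"
  shows "tau1_B r n e r p = (if Suc p = r
      then scal (q powi (- e)) * qbr e (qbr e (B p) (B r)) (B (rho n r)) - Kpow n e r * B p
      else if p = r then Kpow n e r * B r else B p)"
    "tau1_B r n e r (rho n p) = (if Suc p = r
      then scal (q powi (- e)) * qbr e (qbr e (B (rho n p)) (B (rho n r))) (B r) - B (rho n p) * Kpow n e (rho n r)
      else if p = r then B (rho n r) * Kpow n e (rho n r) else B (rho n p))"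
    "tau2_B r n e r p = (if Suc p = r
      then scal (q powi (- e)) * qbr e (B (rho n r)) (qbr e (B r) (B p)) - Kpow n e (rho n r) * B p
      else if p = r then Kpow n e (rho n r) * B r else B p)"
    "tau2_B r n e r (rho n p) = (if Suc p = r
      then scal (q powi (- e)) * qbr e (B r) (qbr e (B (rho n r)) (B (rho n p))) - B (rho n p) * Kpow n e r
      else if p = r then B (rho n r) * Kpow n e r else B (rho n p))"
  using assms by (auto simp: tau1_B_def tau2_B_def rho_def)

lemma tau_B_odd_tip:
  assumes "n = 2 * r + 1" and p: "1 \<le> p" "p \<le> r"
  shows "tau1_B r n e (Suc r) p = (if p = r then qbr (- e) (B (Suc r)) (B r) else B p)"
    "tau1_B r n e (Suc r) (rho n p) = (if p = r then qbr e (B (rho n r)) (B (Suc r)) else B (rho n p))"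
    "tau2_B r n e (Suc r) p = (if p = r then qbr e (B (Suc r)) (B r) else B p)"
    "tau2_B r n e (Suc r) (rho n p) = (if p = r then qbr (- e) (B (rho n r)) (B (Suc r)) else B (rho n p))"
    "tau1_B r n e (Suc r) (Suc r) = B (Suc r)" "tau2_B r n e (Suc r) (Suc r) = B (Suc r)"
  using assms by (auto simp: tau1_B_def tau2_B_def rho_def)

lemma cc_braid: "i < Nr n \<Longrightarrow> cc r n (Suc i) = 1"
  using n by (auto simp: cc_def Nr_def)

lemma Kpow_braid:
  assumes "1 \<le> i" "i < Nr n"
  shows "word_act (iU_op r n) (Kpow n e i) = diag_op (q powi e) (\<lambda>a. a i - a (Suc i))"
    "word_act (iU_op r n) (Kpow n e (rho n i)) = diag_op (q powi e) (\<lambda>a. a (Suc i) - a i)"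
proof -
  have "i \<le> r" "\<not> (n = 2 * r \<and> i = r)" using assms n by (auto simp: Nr_def)
  then have w: "weight_K r n i = (\<lambda>a. a i - a (Suc i))"
    using cc_braid[OF assms(2)] by (simp add: weight_K_def fun_eq_iff)
  show "word_act (iU_op r n) (Kpow n e i) = diag_op (q powi e) (\<lambda>a. a i - a (Suc i))"
    "word_act (iU_op r n) (Kpow n e (rho n i)) = diag_op (q powi e) (\<lambda>a. a (Suc i) - a i)"
    using iU_op_Kpow[OF e assms(1) \<open>i \<le> r\<close>] by (simp_all add: w)
qed

lemma Kpow_even_tip:
  assumes "n = 2 * r" "1 \<le> r"
  shows "word_act (iU_op r n) (Kpow n e r) = diag_op (q powi e) (\<lambda>a. a r - 2 * a (Suc r) - 1)"
    "word_act (iU_op r n) (Kpow n e (rho n r)) = diag_op (q powi e) (\<lambda>a. 2 * a (Suc r) + 1 - a r)"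
proof -
  have w: "weight_K r n r = (\<lambda>a. a r - 2 * a (Suc r) - 1)"
    "(\<lambda>a. - weight_K r n r a) = (\<lambda>a. 2 * a (Suc r) + 1 - a r)"
    using assms by (simp_all add: weight_K_def fun_eq_iff cc_def)
  show "word_act (iU_op r n) (Kpow n e r) = diag_op (q powi e) (\<lambda>a. a r - 2 * a (Suc r) - 1)"
    "word_act (iU_op r n) (Kpow n e (rho n r)) = diag_op (q powi e) (\<lambda>a. 2 * a (Suc r) + 1 - a r)"
    using iU_op_Kpow(1)[OF e assms(2) order_refl, unfolded w(1)]
      iU_op_Kpow(2)[OF e assms(2) order_refl, unfolded w(2)] .
qed

lemma word_act_qbr_e:
  "word_act (iU_op r n) (qbr e x y) = op_qbr (q powi e) (word_act (iU_op r n) x) (word_act (iU_op r n) y)"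
  "word_act (iU_op r n) (qbr (- e) x y)
      = op_qbr (inverse (q powi e)) (word_act (iU_op r n) x) (word_act (iU_op r n) y)"
  by (simp_all add: fun_eq_iff word_act_qbr power_int_minus)

lemma word_act_gen_op: "word_act (iU_op r n) (gen g) = iU_op r n g"
  by (rule ext) (rule word_act_gen)

interpretation q_param "q powi e" "inverse (q powi e - inverse (q powi e))"
  by (rule q_param_power[OF e])

lemmas iU_gen_rules = word_act_gen_op iU_op_low iU_op_high iU_op_mid

lemma braid_intertwines_B:
  assumes i: "1 \<le> i" "i < Nr n" and j: "j \<in> {1..n}"
  shows "braid1 (q powi e) i (iU_op r n (GB j) F)
      = word_act (iU_op r n) (tau1_B r n e i j) (braid1 (q powi e) i F)"
    and "braid2 (q powi e) i (iU_op r n (GB j) F)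
        = word_act (iU_op r n) (tau2_B r n e i j) (braid2 (q powi e) i F)"
proof -
  have ir: "i \<le> r" using i n by (auto simp: Nr_def)
  note ops = iU_gen_rules iU_word_rules word_act_qbr_e Kpow_braid[OF i] cc_braid[OF i(2)] ir i(1)
  let ?goal = "braid1 (q powi e) i (iU_op r n (GB j) F)
      = word_act (iU_op r n) (tau1_B r n e i j) (braid1 (q powi e) i F)
    \<and> braid2 (q powi e) i (iU_op r n (GB j) F)
        = word_act (iU_op r n) (tau2_B r n e i j) (braid2 (q powi e) i F)"
  have ?goal using j
  proof (cases rule: index_cases)
    case low
    consider "j = i" | "j = Suc i" | "Suc j = i" | "j \<noteq> i" "j \<noteq> Suc i" "Suc j \<noteq> i" by metis
    then show ?goal
      using braid1_E_below[of j F] braid2_E_below[of j F]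
      by cases (use low in \<open>simp_all add: tau_B_braid[OF i] ops braid1_E braid2_E braid1_E_above braid2_E_above
        braid_commutes_far del: iU_op.simps\<close>)
  next
    case (high p)
    consider "p = i" | "p = Suc i" | "Suc p = i" | "p \<noteq> i" "p \<noteq> Suc i" "Suc p \<noteq> i" by metis
    then show ?goal unfolding high(3)
      using braid1_F_below[of p F] braid2_F_below[of p F]
      by cases (use high i(1) in \<open>simp_all add: tau_B_braid[OF i] ops braid1_F braid2_F
          braid1_F_above braid2_F_above
        braid_commutes_far cc_low del: iU_op.simps\<close>)
  next
    case mid
    consider "i = r" | "i \<noteq> r" by blast
    then show ?goal
    proof cases
      case 1
      show ?thesis
        using i(1)
        by (simp add: 1 mid(2) tau_B_braid_mid[OF mid(1) i, unfolded 1]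
            iU_op_mid[OF mid(1)] Kpow_braid[OF i, unfolded 1]
            cc_braid[OF i(2), unfolded 1] word_act_gen_op iU_op_low iU_op_high iU_word_rules word_act_qbr_e
                braid1_H braid2_H
            del: iU_op.simps)
    next
      case 2
      then show ?thesis
        using ir
            by (simp add: mid(2) tau_B_braid_mid[OF mid(1) i] word_act_gen_op iU_op_mid[OF mid(1)] braid_commutes_H
            del: iU_op.simps)
    qed
  qed
  then show "braid1 (q powi e) i (iU_op r n (GB j) F)
      = word_act (iU_op r n) (tau1_B r n e i j) (braid1 (q powi e) i F)"
    "braid2 (q powi e) i (iU_op r n (GB j) F) = word_act (iU_op r n) (tau2_B r n e i j) (braid2 (q powi e) i F)"
    by simp_all
qed

lemma even_tip_intertwines_B:
  assumes nr: "n = 2 * r" "1 \<le> r" and j: "j \<in> {1..n}"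
  shows "even_tip1 (q powi e) r (iU_op r n (GB j) F)
      = word_act (iU_op r n) (tau1_B r n e r j) (even_tip1 (q powi e) r F)
    \<and> even_tip2 (q powi e) r (iU_op r n (GB j) F)
        = word_act (iU_op r n) (tau2_B r n e r j) (even_tip2 (q powi e) r F)"
proof -
  have cc: "cc r n (Suc r) = 2" using nr by (simp add: cc_def)
  note ops = iU_gen_rules iU_word_rules word_act_qbr_e Kpow_even_tip[OF nr] nr(2) power_int_minus
  from j show ?thesis
  proof (cases rule: index_cases)
    case low
    consider "j = r" | "Suc j = r" | "j < r" "Suc j \<noteq> r" using low by linarith
    then show ?thesis
    proof cases
      case 1
      show ?thesis unfolding 1
        by (simp add: tau_B_even_tip[OF nr(1) nr(2) order_refl] ops even_tip1_E even_tip2_E del: iU_op.simps)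
    next
      case 2
      then show ?thesis
        using low even_tip1_E_below[of j F] even_tip2_E_below[of j F]
        by (simp add: tau_B_even_tip[OF nr(1)] ops cc del: iU_op.simps)
    next
      case 3
      then show ?thesis
        using low by (simp add: tau_B_even_tip[OF nr(1)] ops even_tip_commutes_far del: iU_op.simps)
    qed
  next
    case (high p)
    consider "p = r" | "Suc p = r" | "p < r" "Suc p \<noteq> r" using high by linarith
    then show ?thesis unfolding high(3)
    proof cases
      case 1
      show "even_tip1 (q powi e) r (iU_op r n (GB (rho n p)) F)
          = word_act (iU_op r n) (tau1_B r n e r (rho n p)) (even_tip1 (q powi e) r F)
    \<and> even_tip2 (q powi e) r (iU_op r n (GB (rho n p)) F)
        = word_act (iU_op r n) (tau2_B r n e r (rho n p)) (even_tip2 (q powi e) r F)"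
        unfolding 1 using nr(2)
        by (simp add: tau_B_even_tip[OF nr(1) nr(2) order_refl] ops cc even_tip1_F even_tip2_F del: iU_op.simps)
    next
      case 2
      then show "even_tip1 (q powi e) r (iU_op r n (GB (rho n p)) F)
          = word_act (iU_op r n) (tau1_B r n e r (rho n p)) (even_tip1 (q powi e) r F)
    \<and> even_tip2 (q powi e) r (iU_op r n (GB (rho n p)) F)
        = word_act (iU_op r n) (tau2_B r n e r (rho n p)) (even_tip2 (q powi e) r F)"
        using high even_tip1_F_below[of p F] even_tip2_F_below[of p F] cc_low[of r]
        by (simp add: tau_B_even_tip[OF nr(1)] ops cc del: iU_op.simps)
    next
      case 3
      then show "even_tip1 (q powi e) r (iU_op r n (GB (rho n p)) F)
          = word_act (iU_op r n) (tau1_B r n e r (rho n p)) (even_tip1 (q powi e) r F)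
    \<and> even_tip2 (q powi e) r (iU_op r n (GB (rho n p)) F)
        = word_act (iU_op r n) (tau2_B r n e r (rho n p)) (even_tip2 (q powi e) r F)"
        using high by (simp add: tau_B_even_tip[OF nr(1)] ops even_tip_commutes_far del: iU_op.simps)
    qed
  next
    case mid
    then show ?thesis using nr by simp
  qed
qed

lemma odd_tip_intertwines_B:
  assumes nr: "n = 2 * r + 1" "1 \<le> r" and j: "j \<in> {1..n}"
  shows "odd_tip1 (q powi e) (Suc r) (iU_op r n (GB j) F)
      = word_act (iU_op r n) (tau1_B r n e (Suc r) j) (odd_tip1 (q powi e) (Suc r) F)
    \<and> odd_tip2 (q powi e) (Suc r) (iU_op r n (GB j) F)
        = word_act (iU_op r n) (tau2_B r n e (Suc r) j) (odd_tip2 (q powi e) (Suc r) F)"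
proof -
  have cc: "cc r n (Suc r) = 1" using nr by (simp add: cc_def)
  note ops = iU_gen_rules iU_word_rules word_act_qbr_e nr(2) cc
  from j show ?thesis
  proof (cases rule: index_cases)
    case low
    then show ?thesis
      using iU_op_mid[OF nr(1)]
      by (cases "j = r") (simp_all add: tau_B_odd_tip[OF nr(1)] ops odd_tip1_E odd_tip2_E odd_tip_commutes_far
          del: iU_op.simps)
  next
    case (high p)
    then show ?thesis
      using iU_op_mid[OF nr(1)]
      by (cases "p = r") (simp_all add: tau_B_odd_tip[OF nr(1)] ops odd_tip1_F odd_tip2_F odd_tip_commutes_far
          del: iU_op.simps)
  next
    case mid
    show ?thesis
      by (simp add: mid(2) tau_B_odd_tip[OF nr(1,2) order_refl] word_act_gen_op iU_op_mid[OF nr(1)] odd_tip_commutes_H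
          del: iU_op.simps)
  qed
qed

text \<open>Exchanging \<open>a\<^sub>i\<close> and \<open>a\<^bsub>i+1\<^esub>\<close> transforms the weights of the \<open>K\<^sub>p\<close> in the way in which the simple reflection acts
  on simple roots, and \<open>\<tau>\<close> is defined by the same formula.\<close>
lemma braid_intertwines_K:
  assumes i: "1 \<le> i" "i < Nr n" and p: "1 \<le> p" "p \<le> r"
  shows "braid1 Q i (iU_op r n (GK p) F) = word_act (iU_op r n) (tau_K n i p) (braid1 Q i F)"
    and "braid2 Q i (iU_op r n (GK p) F) = word_act (iU_op r n) (tau_K n i p) (braid2 Q i F)"
proof -
  have ir: "i \<le> r" "\<not> (n = 2 * r \<and> i = r)" using i n by (auto simp: Nr_def)
  have weight: "weight_K r n p (swap_vec i a) = (if p = i then - weight_K r n i a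
      else if p = Suc i \<or> Suc p = i then weight_K r n i a + weight_K r n p a else weight_K r n p a)" for a
    using ir cc_braid[OF i(2)] cc_low[OF ir(1)] by (auto simp: weight_K_def swap_vec_def)
  have K_op: "iU_op r n (GK p) = diag_op q (weight_K r n p)" "iU_op r n (GK i) = diag_op q (weight_K r n i)"
    "iU_op r n (GK (rho n i)) = diag_op q (\<lambda>a. - weight_K r n i a)"
    using p ir rho_gt[OF i(1) ir(1)] rho_rho[OF i(1) ir(1)] by simp_all
  have tau: "tau_K n i p = (if p = i then K (rho n i)
      else if p = Suc i \<or> Suc p = i then K i * K p else K p)"
    using i by (auto simp: tau_K_def)
  show "braid1 Q i (iU_op r n (GK p) F) = word_act (iU_op r n) (tau_K n i p) (braid1 Q i F)"
    "braid2 Q i (iU_op r n (GK p) F) = word_act (iU_op r n) (tau_K n i p) (braid2 Q i F)"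
    by (auto simp: tau braid1_def braid2_def K_op word_act_gen word_act_mult[of "iU_op r n", OF linear_op_iU_op]
        fun_eq_iff
        diag_op_def weight power_int_add simp del: iU_op.simps)
qed

lemma tip_intertwines_K:
  assumes p: "1 \<le> p" "p \<le> r"
  shows "even_tip1 Q i (iU_op r n (GK p) F) = word_act (iU_op r n) (tau_K n (Nr n) p) (even_tip1 Q i F)"
    "even_tip2 Q i (iU_op r n (GK p) F) = word_act (iU_op r n) (tau_K n (Nr n) p) (even_tip2 Q i F)"
    "odd_tip1 Q i (iU_op r n (GK p) F) = word_act (iU_op r n) (tau_K n (Nr n) p) (odd_tip1 Q i F)"
    "odd_tip2 Q i (iU_op r n (GK p) F) = word_act (iU_op r n) (tau_K n (Nr n) p) (odd_tip2 Q i F)"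
  using p by (simp_all add: tau_K_def word_act_gen fun_eq_iff diag_op_def
      even_tip1_def even_tip2_def odd_tip1_def odd_tip2_def)

lemma T_op_intertwines:
  assumes r: "1 \<le> r" and i: "1 \<le> i" "i \<le> Nr n"
  shows "j \<in> {1..n} \<Longrightarrow> T1_op r n e i (iU_op r n (GB j) F)
      = word_act (iU_op r n) (tau1_B r n e i j) (T1_op r n e i F)"
    and "j \<in> {1..n} \<Longrightarrow> T2_op r n e i (iU_op r n (GB j) F)
        = word_act (iU_op r n) (tau2_B r n e i j) (T2_op r n e i F)"
    and "j \<in> {1..r} \<Longrightarrow> T1_op r n e i (iU_op r n (GK j) F) = word_act (iU_op r n) (tau_K n i j) (T1_op r n e i F)"
    and "j \<in> {1..r} \<Longrightarrow> T2_op r n e i (iU_op r n (GK j) F) = word_act (iU_op r n) (tau_K n i j) (T2_op r n e i F)"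
proof -
  consider (swap) "i < Nr n" | (even) "n = 2 * r" "i = r" "Nr n = r"
      | (odd) "n = 2 * r + 1" "i = Suc r" "Nr n = Suc r"
  proof -
    have "i < Nr n \<or> n = 2 * r \<and> i = r \<and> Nr n = r \<or> n = 2 * r + 1 \<and> i = Suc r \<and> Nr n = Suc r"
      using i n by (auto simp: Nr_def)
    then show thesis using that by blast
  qed
  then have all: "(j \<in> {1..n} \<longrightarrow> T1_op r n e i (iU_op r n (GB j) F)
      = word_act (iU_op r n) (tau1_B r n e i j) (T1_op r n e i F)
      \<and> T2_op r n e i (iU_op r n (GB j) F) = word_act (iU_op r n) (tau2_B r n e i j) (T2_op r n e i F))
    \<and> (j \<in> {1..r} \<longrightarrow> T1_op r n e i (iU_op r n (GK j) F) = word_act (iU_op r n) (tau_K n i j) (T1_op r n e i F)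
      \<and> T2_op r n e i (iU_op r n (GK j) F) = word_act (iU_op r n) (tau_K n i j) (T2_op r n e i F))"
  proof cases
    case swap
    then show ?thesis
      using braid_intertwines_B[OF i(1) swap] braid_intertwines_K[OF i(1) swap]
      by (simp add: T1_op_braid T2_op_braid del: iU_op.simps)
  next
    case even
    show ?thesis
      using even_tip_intertwines_B[OF even(1) r, of j F] tip_intertwines_K[of j, unfolded even(3)]
      by (simp add: even(2) T_op_even_tip[OF even(1)] del: iU_op.simps)
  next
    case odd
    show ?thesis
      using odd_tip_intertwines_B[OF odd(1) r, of j F] tip_intertwines_K[of j, unfolded odd(3)]
      by (simp add: odd(2) T_op_odd_tip[OF odd(1)] del: iU_op.simps)
  qed
  show "j \<in> {1..n} \<Longrightarrow> T1_op r n e i (iU_op r n (GB j) F)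
      = word_act (iU_op r n) (tau1_B r n e i j) (T1_op r n e i F)"
    "j \<in> {1..n} \<Longrightarrow> T2_op r n e i (iU_op r n (GB j) F)
        = word_act (iU_op r n) (tau2_B r n e i j) (T2_op r n e i F)"
    "j \<in> {1..r} \<Longrightarrow> T1_op r n e i (iU_op r n (GK j) F) = word_act (iU_op r n) (tau_K n i j) (T1_op r n e i F)"
    "j \<in> {1..r} \<Longrightarrow> T2_op r n e i (iU_op r n (GK j) F) = word_act (iU_op r n) (tau_K n i j) (T2_op r n e i F)"
    using all by blast+
qed

end

theorem theorem4p5:
  fixes r n i :: nat and e :: int
    and \<phi> :: "igen falg set \<Rightarrow> wgen falg set"
    and \<tau> :: "igen falg set \<Rightarrow> igen falg set"
    and T :: "qpoly \<Rightarrow> qpoly"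
    and u :: "igen falg set" and f :: qpoly
  assumes "r \<ge> 1" and "n = 2 * r \<or> n = 2 * r + 1" and "e \<in> {1, - 1}"
    and "1 \<le> i" and "i \<le> Nr n"
    and "is_phi r n \<phi>"
    and "is_tau1 r n e i \<tau> \<and> T = T1 r n e i \<or> is_tau2 r n e i \<tau> \<and> T = T2 r n e i"
    and "u \<in> carrier (presented (iU r n))" and "f \<in> polys r"
  shows "T (weyl_act r n (\<phi> u) f) = weyl_act r n (\<phi> (\<tau> u)) (T f)"
proof -
  interpret braid_setting r n e
    using assms(2,3) by unfold_locales
  obtain b S where \<tau>: "\<tau> \<in> alg_aut (iU r n)" and S: "linear_op S"
    and T: "\<And>f. coeff_fun (T f) = S (coeff_fun f)"
    and B_val: "\<And>j. j \<in> {1..n} \<Longrightarrow> \<tau> (cls (iU r n) (B j)) = cls (iU r n) (b j)"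
    and K_val: "\<And>j. j \<in> {1..r} \<Longrightarrow> \<tau> (cls (iU r n) (K j)) = cls (iU r n) (tau_K n i j)"
    and SB: "\<And>j F. j \<in> {1..n} \<Longrightarrow> S (iU_op r n (GB j) F) = word_act (iU_op r n) (b j) (S F)"
    and SK: "\<And>j F. j \<in> {1..r} \<Longrightarrow> S (iU_op r n (GK j) F) = word_act (iU_op r n) (tau_K n i j) (S F)"
    using assms(7)
  proof
    assume *: "is_tau1 r n e i \<tau> \<and> T = T1 r n e i"
    show thesis
      by (rule that[of "T1_op r n e i" "tau1_B r n e i"])
        (use * in \<open>simp_all add: is_tau1_def linear_op_T1_op coeff_fun_T1
          T_op_intertwines[OF assms(1,4,5)] del: iU_op.simps\<close>)
  next
    assume *: "is_tau2 r n e i \<tau> \<and> T = T2 r n e i"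
    show thesis
      by (rule that[of "T2_op r n e i" "tau2_B r n e i"])
        (use * in \<open>simp_all add: is_tau2_def linear_op_T2_op coeff_fun_T2
          T_op_intertwines[OF assms(1,4,5)] del: iU_op.simps\<close>)
  qed
  have \<tau>h: "\<tau> \<in> alg_hom (iU r n) (iU r n)" using \<tau> by (simp add: alg_aut_def)
  then have \<tau>r: "\<tau> \<in> ring_hom (presented (iU r n)) (presented (iU r n))" by (simp add: alg_hom_def)
  have \<phi>r: "\<phi> \<in> ring_hom (presented (iU r n)) (presented (Aq r n))"
    using assms(6) by (simp add: is_phi_def alg_hom_def)
  have val_closed: "x \<in> carrier (free_alg (fst (iU r n)))"
    if "\<tau> (cls (iU r n) (gen h)) = cls (iU r n) x" "h \<in> fst (iU r n)" for h x
  proof (rule cls_carrier_imp[OF iU_rels_in_free_alg])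
    show "cls (iU r n) x \<in> carrier (presented (iU r n))"
      unfolding that(1)[symmetric]
      by (rule ring_hom_closed[OF \<tau>r ring_hom_closed[OF cls_ring_hom[OF iU_rels_in_free_alg]
            iU_gen_in_free_alg[OF that(2)]]])
  qed
  have b: "b j \<in> carrier (free_alg (fst (iU r n)))" if "j \<in> {1..n}" for j
    by (rule val_closed[OF B_val[OF that]]) (use that in \<open>auto simp: iU_def iU_gens_def\<close>)
  have k: "tau_K n i j \<in> carrier (free_alg (fst (iU r n)))" if "j \<in> {1..r}" for j
    by (rule val_closed[OF K_val[OF that]]) (use that assms(2) in \<open>auto simp: iU_def iU_gens_def rho_def\<close>)
  have "coeff_fun (T (weyl_act r n (\<phi> u) f)) = S (cls_act (weyl_op r n) (\<phi> u) (coeff_fun f))"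
    by (simp only: T coeff_fun_weyl_act[OF ring_hom_closed[OF \<phi>r assms(8)]])
  also have "\<dots> = cls_act (weyl_op r n) (\<phi> (\<tau> u)) (S (coeff_fun f))"
    by (rule intertwine_from_gens[OF assms(6) \<tau>h S B_val K_val b k SB SK assms(8)])
  also have "\<dots> = coeff_fun (weyl_act r n (\<phi> (\<tau> u)) (T f))"
    by (simp only: T coeff_fun_weyl_act[OF ring_hom_closed[OF \<phi>r ring_hom_closed[OF \<tau>r assms(8)]]])
  finally show ?thesis by (rule coeff_fun_inject)
qed

end
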